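(* Assume that $A$ is integer valued. Let $T_n=\ln n$. Assume that there exist $\eta>\zeta>0$ (so $T_n=O(n^\zeta)$), $\alpha>\frac1{\eta-\zeta}$, a number $r$ with $\alpha(\eta-\zeta)>1+r$, and $\delta_0<1/\alpha$ such that $$\int_{|t|\le T_n}|\varphi_n(t)-e^{-t^2}|\,dt=O(n^{-\eta}),\qquad \int_{|t|\le T_n}|\phi_n(t)-e^{-t^2/2}|\,dt=O(n^{-\eta}),$$ and for $\mu$-a.a. $\omega$, $\|S_n^\omega A-S_k^\omega A\|_{L^1(\widehat\mu_\omega)}=O(n^{\delta_0/2}(n-k)^{1/2})$ for all $k<n$. Assume also that there exist constants $\delta\in(0,1)$, $C,c>0$ and $b>2$ such that $$\left|\int e^{i\theta S_n\widehat A}\,d\widehat\mu^{(2)}\right|\le Ce^{-c\theta^2n}\quad\text{for all }\theta\in[-\delta,\delta]\text{ and } n\in\mathbb N,$$ and $$\int_{\delta\le|\theta|\le\pi}\left|\int e^{i\theta S_n\widehat A}\,d\widehat\mu^{(2)}\right|d\theta=O(n^{-b}).$$ Then for every function $G:\mathbb R\to\mathbb R$ that is continuous with compact support or the indicator of a bounded interval, $$\lim_{n\to\infty}\sup_{u\in\mathbb Z}\left|\sqrt{2\pi n}\int G(S_n^\omega A-u)\,d\widehat\mu_\omega-e^{-\frac{u^2}{2n}}\sum_{k\in\mathbb Z}G(k)\right|=0$$ for $\mu$-almost every $\omega$.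
   Context: Let $(\Sigma,\mathcal F,\mu)$ be a probability space and $T:\Sigma\to\Sigma$ a measurable $\mu$-preserving map. Let $X$ be a measurable space and $X_\omega\subset X$, $\omega\in\Sigma$, subsets such that $\mathcal E=\{(\omega,x):\omega\in\Sigma,\ x\in X_\omega\}$ is a measurable subset of $\Sigma\times X$. Let $f_\omega:X_\omega\to X_{T\omega}$ be maps such that $F_1:\mathcal E\to\mathcal E$, $F_1(\omega,x)=(T\omega,f_\omega x)$, is measurable. Let $\mathcal E_2=\{(\omega,x,y):\omega\in\Sigma,\ x,y\in X_\omega\}$ and $F_2(\omega,x,y)=(T\omega,f_\omega x,f_\omega y)$. Write $f_\omega^0=\mathrm{id}$, $f_\omega^j=f_{T^{j-1}\omega}\circ\cdots\circ f_\omega$. Fix a probability measure $\widehat\mu=\int\widehat\mu_\omega\,d\mu(\omega)$ on $\mathcal E$, where $\widehat\mu_\omega$ is a probability measure on $X_\omega$; it is not assumed $F_1$-invariant. Put $\widehat\mu^{(2)}=\int\widehat\mu_\omega\times\widehat\mu_\omega\,d\mu(\omega)$. Let $A:X\to\mathbb R$ be measurable, $S_n^\omega A=\sum_{j=0}^{n-1}A\circ f_\omega^j$, $S_nA(\omega,x)=S_n^\omega A(x)$, $\widehat A(x,y)=A(x)-A(y)$, and $S_n\widehat A(\omega,x,y)=S_n^\omega A(x)-S_n^\omega A(y)$. Put $$\varphi_n(t)=\int e^{itS_n\widehat A/\sqrt n}\,d\widehat\mu^{(2)},\qquad \phi_n(t)=\int e^{itS_nA/\sqrt n}\,d\widehat\mu.$$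 All asymptotics are as $n\to\infty$; implied constants in statements for fixed $\omega$ may depend on $\omega$. *)

theory Defs
  imports "HOL-Probability.Probability" "HOL-Library.Landau_Symbols"
begin

text \<open>
  A skew product over a measure preserving system \<open>(M, T)\<close> with fibres \<open>Xs \<omega> \<subseteq> space X\<close>, fibre maps
  \<open>f \<omega>\<close>, and fibre measures \<open>mu \<omega>\<close>. The total space \<open>{(\<omega>, x). x \<in> Xs \<omega>}\<close> is \<open>Sigma (space M) Xs\<close>.
  Each \<open>mu \<omega>\<close> lives on the measurable space \<open>Xs \<omega>\<close> itself rather than on \<open>X\<close>, since the values
  of \<open>f \<omega>\<close> outside \<open>Xs \<omega>\<close> are arbitrary and need not be measurable. The family \<open>mu\<close> is not assumed
  to be equivariant.
\<close>

locale fibred_system = prob_space M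
  for M :: "'w measure" and T :: "'w \<Rightarrow> 'w" and X :: "'x measure"
    and Xs :: "'w \<Rightarrow> 'x set" and f :: "'w \<Rightarrow> 'x \<Rightarrow> 'x" and mu :: "'w \<Rightarrow> 'x measure" +
  assumes T_measurable: "T \<in> M \<rightarrow>\<^sub>M M"
    and T_preserving: "distr M M T = M"
    and fibre_subset: "\<And>\<omega>. \<omega> \<in> space M \<Longrightarrow> Xs \<omega> \<subseteq> space X"
    and total_space_measurable: "Sigma (space M) Xs \<in> sets (M \<Otimes>\<^sub>M X)"
    and fibre_map: "\<And>\<omega>. \<omega> \<in> space M \<Longrightarrow> f \<omega> \<in> Xs \<omega> \<rightarrow> Xs (T \<omega>)"
    and skew_measurable: "(\<lambda>(\<omega>, x). (T \<omega>, f \<omega> x)) \<in>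
          restrict_space (M \<Otimes>\<^sub>M X) (Sigma (space M) Xs) \<rightarrow>\<^sub>M
          restrict_space (M \<Otimes>\<^sub>M X) (Sigma (space M) Xs)"
    and fibre_measure_prob: "\<And>\<omega>. \<omega> \<in> space M \<Longrightarrow> prob_space (mu \<omega>)"
    and fibre_measure_sets: "\<And>\<omega>. \<omega> \<in> space M \<Longrightarrow> sets (mu \<omega>) = sets (restrict_space X (Xs \<omega>))"
    and fibre_measure_measurable:
          "\<And>B. B \<in> sets (restrict_space (M \<Otimes>\<^sub>M X) (Sigma (space M) Xs)) \<Longrightarrow>
             (\<lambda>\<omega>. emeasure (mu \<omega>) (Pair \<omega> -` B)) \<in> borel_measurable M"

text \<open>
  The measures \<open>\<integral> mu \<omega> d\<omega>\<close> on \<open>{(\<omega>, x). x \<in> Xs \<omega>}\<close> and \<open>\<integral> mu \<omega> \<times> mu \<omega> d\<omega>\<close> on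
  \<open>{(\<omega>, x, y). x \<in> Xs \<omega> \<and> y \<in> Xs \<omega>}\<close>.
\<close>

definition muhat :: "'w measure \<Rightarrow> 'x measure \<Rightarrow> ('w \<Rightarrow> 'x set) \<Rightarrow> ('w \<Rightarrow> 'x measure) \<Rightarrow> ('w \<times> 'x) measure"
  where "muhat M X Xs mu =
    M \<bind> (\<lambda>\<omega>. distr (mu \<omega>) (restrict_space (M \<Otimes>\<^sub>M X) (Sigma (space M) Xs)) (Pair \<omega>))"

definition muhat2 :: "'w measure \<Rightarrow> 'x measure \<Rightarrow> ('w \<Rightarrow> 'x set) \<Rightarrow> ('w \<Rightarrow> 'x measure) \<Rightarrow> ('w \<times> 'x \<times> 'x) measure"
  where "muhat2 M X Xs mu =
    M \<bind> (\<lambda>\<omega>. distr (mu \<omega> \<Otimes>\<^sub>M mu \<omega>)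
      (restrict_space (M \<Otimes>\<^sub>M X \<Otimes>\<^sub>M X) (SIGMA \<omega>:space M. Xs \<omega> \<times> Xs \<omega>)) (Pair \<omega>))"

primrec fibre_iter :: "('w \<Rightarrow> 'w) \<Rightarrow> ('w \<Rightarrow> 'x \<Rightarrow> 'x) \<Rightarrow> nat \<Rightarrow> 'w \<Rightarrow> 'x \<Rightarrow> 'x" where
  "fibre_iter T f 0 \<omega> = id"
| "fibre_iter T f (Suc j) \<omega> = f ((T ^^ j) \<omega>) \<circ> fibre_iter T f j \<omega>"

definition birkhoff :: "('w \<Rightarrow> 'w) \<Rightarrow> ('w \<Rightarrow> 'x \<Rightarrow> 'x) \<Rightarrow> ('x \<Rightarrow> real) \<Rightarrow> nat \<Rightarrow> 'w \<Rightarrow> 'x \<Rightarrow> real"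
  where "birkhoff T f A n \<omega> x = (\<Sum>j<n. A (fibre_iter T f j \<omega> x))"

definition birkhoff_diff :: "('w \<Rightarrow> 'w) \<Rightarrow> ('w \<Rightarrow> 'x \<Rightarrow> 'x) \<Rightarrow> ('x \<Rightarrow> real) \<Rightarrow> nat \<Rightarrow> 'w \<times> 'x \<times> 'x \<Rightarrow> real"
  where "birkhoff_diff T f A n = (\<lambda>(\<omega>, x, y). birkhoff T f A n \<omega> x - birkhoff T f A n \<omega> y)"

text \<open>
  \<open>char_sum\<close> and \<open>char_diff\<close> are unnormalised; the central limit scaling is obtained at \<open>t / sqrt n\<close>.
\<close>

definition char_sum :: "'w measure \<Rightarrow> ('w \<Rightarrow> 'w) \<Rightarrow> 'x measure \<Rightarrow> ('w \<Rightarrow> 'x set) \<Rightarrow>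
    ('w \<Rightarrow> 'x \<Rightarrow> 'x) \<Rightarrow> ('w \<Rightarrow> 'x measure) \<Rightarrow> ('x \<Rightarrow> real) \<Rightarrow> nat \<Rightarrow> real \<Rightarrow> complex"
  where
  "char_sum M T X Xs f mu A n \<theta> =
     (CLINT z|muhat M X Xs mu. iexp (\<theta> * birkhoff T f A n (fst z) (snd z)))"

definition char_diff :: "'w measure \<Rightarrow> ('w \<Rightarrow> 'w) \<Rightarrow> 'x measure \<Rightarrow> ('w \<Rightarrow> 'x set) \<Rightarrow>
    ('w \<Rightarrow> 'x \<Rightarrow> 'x) \<Rightarrow> ('w \<Rightarrow> 'x measure) \<Rightarrow> ('x \<Rightarrow> real) \<Rightarrow> nat \<Rightarrow> real \<Rightarrow> complex"
  where
  "char_diff M T X Xs f mu A n \<theta> =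
     (CLINT z|muhat2 M X Xs mu. iexp (\<theta> * birkhoff_diff T f A n z))"

end

theory Submission
  imports Defs "HOL-Real_Asymp.Real_Asymp"
begin

text \<open>
  Write \<open>\<phi>\<close> for the characteristic function of \<open>S\<^sub>n\<close> under the fibre measure \<open>mu \<omega>\<close>; it is a
  random function of \<open>\<omega>\<close>. The averaged characteristic function \<open>char_sum\<close> is its expectation, and
  \<open>char_diff\<close> is the expectation of \<open>|\<phi>|\<^sup>2\<close>, because \<open>x\<close> and \<open>y\<close> are independent given \<open>\<omega>\<close>
  (\<open>char_sum_eq\<close>, \<open>char_diff_eq\<close>). Hence the hypotheses control the second moment
  \<open>E|\<phi>(t / sqrt n) - exp (- t\<^sup>2 / 2)|\<^sup>2 = (char_diff - exp (- t\<^sup>2)) - 2 exp (- t\<^sup>2 / 2) Re (char_sum - exp (- t\<^sup>2 / 2))\<close>,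
  and the theorem passes from these averages to almost every fibre by Borel-Cantelli arguments.

  In a fixed fibre \<open>S\<^sub>n\<close> is integer valued, so inverting its Fourier series on \<open>[-\<pi>, \<pi>]\<close> and comparing
  with the Fourier transform of the Gaussian bounds
  \<open>|sqrt (2 \<pi> n) P(S\<^sub>n = m) - exp (- m\<^sup>2 / (2 n))|\<close>, uniformly in the integer \<open>m\<close>, by three terms
  (\<open>local_limit_error_bound\<close>): an inner integral of \<open>|\<phi>(t / sqrt n) - exp (- t\<^sup>2 / 2)|\<close> over \<open>|t| \<le> L\<close>,
  an outer integral of \<open>sqrt n |\<phi>|\<close> over \<open>L / sqrt n < |\<theta>| \<le> \<pi>\<close>, and a Gaussian tail. The choice
  \<open>L = ln n / 2\<close> makes all three vanish almost surely.

  The outer integral (\<open>outer_part_tendsto_0\<close>): by Cauchy-Schwarz its square has expectation at most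
  \<open>2 \<pi> n\<close> times the integral of \<open>E|\<phi>|\<^sup>2\<close>. Near zero this is at most of order \<open>n exp (- c (ln n)\<^sup>2 / 4)\<close>, and away from
  zero it is \<open>O(n powr (1 - b))\<close> with \<open>b > 2\<close>. Both are summable over all \<open>n\<close>.

  The inner integral: its square has expectation \<open>O(ln n * n powr - \<eta>)\<close> only, which need not be
  summable over all \<open>n\<close>, but is summable along \<open>p k = \<lceil>k powr \<alpha>\<rceil>\<close> since \<open>\<alpha> (\<eta> - \<zeta>) > 1\<close>
  (\<open>inner_part_tendsto_0\<close>). The gap between consecutive terms of this sequence near \<open>n\<close> is
  at most of order \<open>n powr (1 - 1/\<alpha>)\<close>, so the \<open>L\<^sup>1\<close> bound on \<open>S\<^sub>n - S\<^sub>k\<close> changes \<open>\<phi>(t / sqrt n)\<close> by at most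
  \<open>|t|\<close> times a negative power of \<open>n\<close> when \<open>n\<close> is replaced by the preceding term; here
  \<open>\<delta>0 < 1/\<alpha>\<close> enters (\<open>inner_part_interpolation\<close>).

  Finally a test function \<open>G\<close> of bounded support sees only finitely many lattice points around \<open>u\<close>, at
  which the Gaussian factor differs from its value at \<open>u\<close> by \<open>O(1 / sqrt n)\<close>, as
  \<open>exp (- x\<^sup>2 / 2)\<close> is Lipschitz (\<open>lattice_sum_error_bound\<close>).
\<close>

section \<open>Integrals over bounded sets of frequencies\<close>

text \<open>
  Expectations over \<open>\<omega>\<close>, or over a single distribution, are exchanged with frequency integrals throughout.
  Boundedness and the finite measure of the frequency set stand in for integrability hypotheses.
\<close>
lemma fubini_bounded_set_integral:
  fixes h :: "'a \<times> real \<Rightarrow> 'b::{banach, second_countable_topology}"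
  assumes "prob_space N" and h[measurable]: "h \<in> borel_measurable (N \<Otimes>\<^sub>M borel)"
    and bound: "\<And>x t. x \<in> space N \<Longrightarrow> norm (h (x, t)) \<le> B"
    and S[measurable]: "S \<in> sets borel" and fin: "emeasure lborel S < \<infinity>"
  shows "integrable N (\<lambda>x. LBINT t:S. h (x, t))"
    and "set_integrable lborel S (\<lambda>t. \<integral>x. h (x, t) \<partial>N)"
    and "(LBINT t:S. (\<integral>x. h (x, t) \<partial>N)) = (\<integral>x. (LBINT t:S. h (x, t)) \<partial>N)"
proof -
  interpret N: prob_space N by fact
  interpret P: pair_sigma_finite N lborel ..
  have h'[measurable]: "h \<in> borel_measurable (N \<Otimes>\<^sub>M lborel)"
    using h by (simp cong: measurable_cong_sets)
  have int: "integrable (N \<Otimes>\<^sub>M lborel) (\<lambda>(x, t). indicator S t *\<^sub>R h (x, t))"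
  proof (rule Bochner_Integration.integrable_bound)
    have "emeasure (N \<Otimes>\<^sub>M lborel) (space N \<times> S) < \<infinity>"
      using fin by (simp add: lborel.emeasure_pair_measure_Times N.emeasure_space_1)
    then show "integrable (N \<Otimes>\<^sub>M lborel) (\<lambda>z. B * indicator (space N \<times> S) z)"
      by (intro integrable_mult_right integrable_real_indicator) auto
    show "AE z in N \<Otimes>\<^sub>M lborel. norm (case z of (x, t) \<Rightarrow> indicator S t *\<^sub>R h (x, t))
        \<le> norm (B * indicator (space N \<times> S) z)"
      using AE_space
    proof eventually_elim
      case (elim z)
      then have "norm (h (fst z, snd z)) \<le> B" 
        by (intro bound) (auto simp: space_pair_measure)
      with elim show ?case
        by (auto simp: space_pair_measure indicator_def split: prod.splits)
    qed
  qed measurable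
  show "integrable N (\<lambda>x. LBINT t:S. h (x, t))"
    using P.integrable_fst[OF int] by (simp add: set_lebesgue_integral_def)
  show "set_integrable lborel S (\<lambda>t. \<integral>x. h (x, t) \<partial>N)"
    using P.integrable_snd[OF int] by (simp add: set_integrable_def)
  show "(LBINT t:S. (\<integral>x. h (x, t) \<partial>N)) = (\<integral>x. (LBINT t:S. h (x, t)) \<partial>N)"
    using P.Fubini_integral[OF int] by (simp add: set_lebesgue_integral_def)
qed

text \<open>
  The quadratic \<open>a \<mapsto> \<integral> (g - a)\<^sup>2\<close> is nonnegative; this is evaluated at the mean of \<open>g\<close>.
\<close>
lemma set_integral_cauchy_schwarz:
  fixes g :: "real \<Rightarrow> real"
  assumes "set_integrable lborel S g" "set_integrable lborel S (\<lambda>t. (g t)\<^sup>2)"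
    and S: "S \<in> sets lborel" "emeasure lborel S \<le> ennreal l" and "l \<ge> 0"
  shows "(LBINT t:S. g t)\<^sup>2 \<le> l * (LBINT t:S. (g t)\<^sup>2)"
proof -
  define I J where "I = (LBINT t:S. g t)" and "J = (LBINT t:S. (g t)\<^sup>2)"
  have fin: "emeasure lborel S < \<infinity>" 
    using S(2) by (metis ennreal_less_top infinity_ennreal_def order.strict_trans1)
  have ml: "measure lborel S \<le> l" 
    using S(2) \<open>l \<ge> 0\<close> by (simp add: measure_def enn2real_leI)
  have *: "0 \<le> J - 2 * a * I + a\<^sup>2 * l" for a
  proof -
    have "0 \<le> (LBINT t:S. (g t)\<^sup>2 - 2 * a * g t + a\<^sup>2)"
    proof -
      have "(g t)\<^sup>2 - 2 * a * g t + a\<^sup>2 = (g t - a)\<^sup>2" for t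
        by (simp add: power2_eq_square algebra_simps)
      then show ?thesis by (simp add: set_lebesgue_integral_def)
    qed
    also have "\<dots> = J - 2 * a * I + a\<^sup>2 * measure lborel S"
    proof -
      have c: "set_integrable lborel S (\<lambda>t. a\<^sup>2)"
        using S fin by (simp add: set_integrable_def)
      have d: "set_integrable lborel S (\<lambda>t. 2 * a * g t)"
        using assms(1) by (intro set_integrable_mult_right) auto
      have e: "set_integrable lborel S (\<lambda>t. (g t)\<^sup>2 - 2 * a * g t)"
        using assms(2) d by (rule set_integral_diff)
      show ?thesis
        using set_integral_add(2)[OF e c] set_integral_diff(2)[OF assms(2) d] fin S(1)
        by (simp add: I_def J_def set_lebesgue_integral_def mult.commute)
    qed
    also have "\<dots> \<le> J - 2 * a * I + a\<^sup>2 * l"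
      using ml by (simp add: mult_left_mono)
    finally show ?thesis .
  qed
  show ?thesis
  proof (cases "l = 0")
    case True
    \<comment> \<open>Now the quadratic is affine in \<open>a\<close> and bounded below, so its slope vanishes.\<close>
    have J: "J \<ge> 0" by (simp add: J_def set_lebesgue_integral_def)
    have "I = 0"
    proof (rule ccontr)
      assume "I \<noteq> 0"
      then show False using *[of "(J + 1) / (2 * I)"] True J by (simp add: field_simps)
    qed
    then show ?thesis using True by (simp add: I_def)
  next
    case False
    then have "l > 0" using \<open>l \<ge> 0\<close> by simp
    then have "I\<^sup>2 \<le> l * J"
      using *[of "I / l"] by (simp add: power2_eq_square field_simps)
    then show ?thesis by (simp add: I_def J_def)
  qed
qed

section \<open>Fourier inversion on the integers\<close>
lemma integral_iexp_period:
  fixes j :: int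
  shows "(CLBINT \<theta>:{-pi..pi}. iexp (\<theta> * of_int j)) = (if j = 0 then 2 * pi else 0)"
proof (cases "j = 0")
  case True
  then show ?thesis by (simp add: set_lebesgue_integral_def scaleR_conv_of_real)
next
  case False
  let ?F = "\<lambda>\<theta>. iexp (\<theta> * of_int j) / (\<i> * of_int j)"
  have "(CLBINT \<theta>:{-pi..pi}. iexp (\<theta> * of_int j)) = ?F pi - ?F (-pi)"
    unfolding set_lebesgue_integral_def
  proof (rule integral_FTC_Icc)
    fix x :: real
    have "((\<lambda>\<theta>. exp (\<i> * (of_real \<theta> * of_int j)) / (\<i> * of_int j)) has_vector_derivative
        exp (\<i> * (of_real x * of_int j))) (at x within {-pi..pi})"
    proof -
      have "((\<lambda>z. exp (\<i> * (z * of_int j)) / (\<i> * of_int j)) has_field_derivative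
        exp (\<i> * (of_real x * of_int j))) (at (of_real x))"
        using False by (auto intro!: derivative_eq_intros simp: field_simps)
      then show ?thesis
        using has_vector_derivative_real_field has_vector_derivative_at_within by blast
    qed
    then show "(?F has_vector_derivative iexp (x * of_int j)) (at x within {-pi..pi})"
      by simp
  qed (auto intro!: continuous_intros)
  also have "iexp (pi * of_int j) = iexp (- pi * of_int j)"
    using cis_multiple_2pi[of j]
    by (subst exp_eq) (auto intro!: exI[of _ j] simp: algebra_simps)
  finally show ?thesis using False by simp
qed

text \<open>
  By Fubini the right-hand side is the mean of \<open>\<integral> iexp (\<theta> (x - m))\<close>, and the characters are orthogonal
  on \<open>[-\<pi>, \<pi>]\<close>.
\<close>
lemma lattice_inversion:
  fixes m :: int
  assumes "real_distribution Q" and int: "AE x in Q. x \<in> \<int>"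
  shows "complex_of_real (2 * pi * measure Q {of_int m})
    = (CLBINT \<theta>:{-pi..pi}. iexp (- (\<theta> * of_int m)) * char Q \<theta>)"
proof -
  interpret Q: real_distribution Q by fact
  have "(CLBINT \<theta>:{-pi..pi}. iexp (- (\<theta> * of_int m)) * char Q \<theta>)
      = (CLBINT \<theta>:{-pi..pi}. (CLINT x|Q. iexp (\<theta> * (x - of_int m))))"
    unfolding char_def
    by (intro set_lebesgue_integral_cong)
       (auto simp flip: integral_mult_right_zero exp_add simp: algebra_simps)
  also have "\<dots> = (CLINT x|Q. (CLBINT \<theta>:{-pi..pi}. iexp (\<theta> * (x - of_int m))))"
    using fubini_bounded_set_integral(3)[of Q "\<lambda>(x, \<theta>). iexp (\<theta> * (x - of_int m))" 1 "{-pi..pi}"]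
      Q.prob_space_axioms by (simp del: of_real_mult of_real_diff)
  also have "\<dots> = (CLINT x|Q. complex_of_real (2 * pi * indicator {of_int m} x))"
  proof (rule integral_cong_AE)
    show "AE x in Q. (CLBINT \<theta>:{-pi..pi}. iexp (\<theta> * (x - of_int m)))
        = complex_of_real (2 * pi * indicator {of_int m} x)"
      using int
    proof eventually_elim
      case (elim x)
      then obtain i where i: "x = of_int i" by (auto elim: Ints_cases)
      show ?case using integral_iexp_period[of "i - m"] by (auto simp: i indicator_def)
    qed
    show "(\<lambda>x. CLBINT \<theta>:{-pi..pi}. iexp (\<theta> * (x - of_int m))) \<in> borel_measurable Q"
      using fubini_bounded_set_integral(1)[of Q "\<lambda>(x, \<theta>). iexp (\<theta> * (x - of_int m))" 1 "{-pi..pi}"]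
        Q.prob_space_axioms by (simp del: of_real_mult of_real_diff)
  qed simp
  also have "\<dots> = complex_of_real (2 * pi * measure Q {of_int m})"
    by (simp only: integral_complex_of_real) simp
  finally show ?thesis ..
qed

text \<open>
  This is the known characteristic function of the standard normal distribution, rewritten as a Lebesgue integral.
\<close>
lemma gauss_fourier:
  "(CLBINT t. iexp (t * y) * exp (- (t\<^sup>2 / 2))) = sqrt (2 * pi) * exp (- (y\<^sup>2 / 2))"
proof -
  have "char std_normal_distribution y = (CLBINT t. std_normal_density t *\<^sub>R iexp (y * t))"
    unfolding char_def by (subst integral_density) auto
  also have "\<dots> = (CLBINT t. (1 / sqrt (2 * pi)) *\<^sub>R (iexp (t * y) * exp (- (t\<^sup>2 / 2))))"
    unfolding std_normal_density_def
    by (intro Bochner_Integration.integral_cong) (auto simp: scaleR_conv_of_real mult_ac exp_of_real)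
  also have "\<dots> = (1 / sqrt (2 * pi)) *\<^sub>R (CLBINT t. iexp (t * y) * exp (- (t\<^sup>2 / 2)))"
    by (rule integral_scaleR_right)
  finally show ?thesis
    unfolding char_std_normal_distribution
    by (simp add: scaleR_conv_of_real field_simps exp_of_real del: of_real_exp flip: of_real_mult)
qed

lemma integrable_gauss: "integrable lborel (\<lambda>t::real. exp (- (t\<^sup>2 / 2)))"
proof -
  have "integrable lborel (\<lambda>t. sqrt (2 * pi) * std_normal_density t)" by simp
  then show ?thesis by (simp add: std_normal_density_def)
qed

lemma set_integrable_bounded:
  fixes f :: "real \<Rightarrow> 'b::{banach, second_countable_topology}"
  assumes "S \<in> sets borel" "emeasure lborel S < \<infinity>" "f \<in> borel_measurable borel"
    and "\<And>t. norm (f t) \<le> B"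
  shows "set_integrable lborel S f"
  unfolding set_integrable_def
  using assms by (intro integrableI_bounded_set_indicator[where B=B]) auto

lemma emeasure_abs_le: "emeasure lborel {t::real. \<bar>t\<bar> \<le> L} \<le> ennreal (2 * \<bar>L\<bar>)"
proof -
  have "{t::real. \<bar>t\<bar> \<le> L} = {-L..L}" by auto
  then show ?thesis by (cases "L \<ge> 0") (auto simp: emeasure_lborel_Icc_eq)
qed

lemma emeasure_subset_abs_le:
  assumes "S \<subseteq> {t::real. \<bar>t\<bar> \<le> L}"
  shows "emeasure lborel S \<le> ennreal (2 * \<bar>L\<bar>)" "emeasure lborel S < \<infinity>"
proof -
  show "emeasure lborel S \<le> ennreal (2 * \<bar>L\<bar>)"
    using emeasure_mono[OF assms, of lborel] emeasure_abs_le[of L] by (auto intro: order_trans)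
  then show "emeasure lborel S < \<infinity>"
    by (metis ennreal_less_top infinity_ennreal_def order.strict_trans1)
qed

text \<open>
  The probability of \<open>m\<close> is an integral of \<open>\<phi>\<close> over \<open>[-\<pi>, \<pi>]\<close>, and the Gaussian weight is an integral
  over the whole line with the same oscillating factor, which has modulus one. Splitting the first
  at \<open>|\<theta>| = L / sqrt n\<close> and the second at \<open>|t| = L\<close>, and rescaling \<open>\<theta> = t / sqrt n\<close>, the central pieces
  can be compared and the others are bounded by their absolute values. The common factor
  \<open>1 / sqrt (2 \<pi>)\<close> of the three terms is estimated by one.
\<close>
lemma local_limit_error_bound:
  fixes m :: int
  assumes Q: "real_distribution Q" and int: "AE x in Q. x \<in> \<int>"
    and n: "n > 0" and L: "L \<le> pi * sqrt n"
  shows "\<bar>sqrt (2 * pi * n) * measure Q {of_int m} - exp (- ((of_int m)\<^sup>2 / (2 * n)))\<bar>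
    \<le> (LBINT t:{t. \<bar>t\<bar> \<le> L}. cmod (char Q (t / sqrt n) - complex_of_real (exp (- (t\<^sup>2 / 2)))))
      + sqrt n * (LBINT \<theta>:{\<theta>. L / sqrt n < \<bar>\<theta>\<bar> \<and> \<bar>\<theta>\<bar> \<le> pi}. cmod (char Q \<theta>))
      + (LBINT t:{t. L < \<bar>t\<bar>}. exp (- (t\<^sup>2 / 2)))"
    (is "_ \<le> ?in + sqrt n * ?out + ?tail")
proof -
  interpret Q: real_distribution Q by fact
  define F where "F \<theta> = iexp (- (\<theta> * of_int m)) * char Q \<theta>" for \<theta>
  define W where "W t = iexp (- (t * (of_int m / sqrt n)))" for t
  define I O' where "I = {\<theta>::real. \<bar>\<theta>\<bar> \<le> L / sqrt n}" and "O' = {\<theta>. L / sqrt n < \<bar>\<theta>\<bar> \<and> \<bar>\<theta>\<bar> \<le> pi}"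
  define E where "E t = complex_of_real (exp (- (t\<^sup>2 / 2)))" for t :: real
  have [measurable]: "F \<in> borel_measurable borel" "W \<in> borel_measurable borel"
    "E \<in> borel_measurable borel" unfolding F_def W_def E_def by measurable
  have [measurable]: "I \<in> sets borel" "O' \<in> sets borel" unfolding I_def O'_def by measurable
  have normW: "cmod (W t) = 1" for t unfolding W_def by (simp flip: of_real_mult of_real_minus of_real_divide)
  have normiexp: "cmod (iexp a) = 1" for a by simp
  have normF: "cmod (F \<theta>) = cmod (char Q \<theta>)" for \<theta> 
    unfolding F_def by (simp only: norm_mult normiexp)
  have sn: "sqrt n > 0" using n by simp
  have fin: "emeasure lborel I < \<infinity>" "emeasure lborel O' < \<infinity>" "emeasure lborel {t::real. \<bar>t\<bar> \<le> L} < \<infinity>"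
    using emeasure_subset_abs_le(2)[of I "L / sqrt n"] emeasure_subset_abs_le(2)[of O' pi]
      emeasure_subset_abs_le(2)[of "{t::real. \<bar>t\<bar> \<le> L}" L]
    by (auto simp: I_def O'_def)
  have iF: "set_integrable lborel S F" if "S \<in> sets borel" "emeasure lborel S < \<infinity>" for S
    using that by (intro set_integrable_bounded[where B=1]) (auto simp: normF Q.cmod_char_le_1)
  have iWE: "integrable lborel (\<lambda>t. W t * E t)"
    using integrable_gauss 
    by (rule Bochner_Integration.integrable_bound) (auto simp: norm_mult normW E_def)
  have iWE': "set_integrable lborel S (\<lambda>t. W t * E t)" if "S \<in> sets borel" for S
    unfolding set_integrable_def using iWE that by (intro integrable_mult_indicator) auto
  have "complex_of_real (sqrt n * (2 * pi * measure Q {of_int m})) = sqrt n * (CLBINT \<theta>:{-pi..pi}. F \<theta>)"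
    using lattice_inversion[OF Q int, of m] by (simp add: F_def)
  also have "{-pi..pi} = I \<union> O'"
  proof -
    have "L / sqrt n \<le> pi" using L sn by (simp add: field_simps)
    then show ?thesis by (auto simp: I_def O'_def)
  qed
  also have "(CLBINT \<theta>:I \<union> O'. F \<theta>) = (CLBINT \<theta>:I. F \<theta>) + (CLBINT \<theta>:O'. F \<theta>)"
    using fin by (intro set_integral_Un iF) (auto simp: I_def O'_def)
  also have "(CLBINT \<theta>:I. F \<theta>) = (CLBINT t:{t. \<bar>t\<bar> \<le> L}. F (t / sqrt n)) / sqrt n"
  proof -
    have "indicator I (0 + (1 / sqrt n) * t) = (indicator {t. \<bar>t\<bar> \<le> L} t :: real)" for t
      using sn by (auto simp: I_def indicator_def field_simps abs_mult)
    then show ?thesis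
      using sn unfolding set_lebesgue_integral_def
      by (subst lborel_integral_real_affine[of "1 / sqrt n" _ 0]) (auto simp: scaleR_conv_of_real)
  qed
  finally have P: "complex_of_real (sqrt n * (2 * pi * measure Q {of_int m}))
      = (CLBINT t:{t. \<bar>t\<bar> \<le> L}. F (t / sqrt n)) + sqrt n * (CLBINT \<theta>:O'. F \<theta>)"
    using sn by (simp add: field_simps)
  have "complex_of_real (sqrt (2 * pi) * exp (- ((of_int m)\<^sup>2 / (2 * n)))) = (CLBINT t. W t * E t)"
    using gauss_fourier[of "- (of_int m / sqrt n)"] n by (simp add: W_def E_def power_divide)
  also have "\<dots> = (CLBINT t:{t. \<bar>t\<bar> \<le> L} \<union> {t. L < \<bar>t\<bar>}. W t * E t)"
    unfolding set_lebesgue_integral_def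
    by (intro Bochner_Integration.integral_cong) (auto simp: indicator_def)
  also have "\<dots> = (CLBINT t:{t. \<bar>t\<bar> \<le> L}. W t * E t) + (CLBINT t:{t. L < \<bar>t\<bar>}. W t * E t)"
    by (intro set_integral_Un iWE') auto
  finally have G: "complex_of_real (sqrt (2 * pi) * exp (- ((of_int m)\<^sup>2 / (2 * n))))
     = (CLBINT t:{t. \<bar>t\<bar> \<le> L}. W t * E t) + (CLBINT t:{t. L < \<bar>t\<bar>}. W t * E t)" .
  have Fn: "F (t / sqrt n) = W t * char Q (t / sqrt n)" for t
    by (simp add: F_def W_def)
  have iFn: "set_integrable lborel {t. \<bar>t\<bar> \<le> L} (\<lambda>t. F (t / sqrt n))"
    using fin by (intro set_integrable_bounded[where B=1]) (auto simp: normF Q.cmod_char_le_1)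
  have D: "(CLBINT t:{t. \<bar>t\<bar> \<le> L}. F (t / sqrt n)) - (CLBINT t:{t. \<bar>t\<bar> \<le> L}. W t * E t)
     = (CLBINT t:{t. \<bar>t\<bar> \<le> L}. W t * (char Q (t / sqrt n) - E t))"
    by (subst set_integral_diff(2)[symmetric, OF iFn iWE']) (auto simp: Fn algebra_simps)
  have bound: "cmod (CLBINT t:S. f t) \<le> (LBINT t:S. cmod (f t))" for S f
    using integral_norm_bound[of lborel "\<lambda>t. indicator S t *\<^sub>R f t"]
    by (simp add: set_lebesgue_integral_def)
  define X where "X = sqrt (2 * pi * n) * measure Q {of_int m} - exp (- ((of_int m)\<^sup>2 / (2 * n)))"
  have "sqrt (2 * pi) * X = sqrt n * (2 * pi * measure Q {of_int m}) 
      - sqrt (2 * pi) * exp (- ((of_int m)\<^sup>2 / (2 * n)))"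
  proof -
    have "sqrt (2 * pi) * sqrt (2 * pi * n) = 2 * pi * sqrt n"
      unfolding real_sqrt_mult[of "2 * pi" n] mult.assoc[symmetric] real_sqrt_mult_self by simp
    then show ?thesis
      unfolding X_def right_diff_distrib mult.assoc[symmetric] by (simp only: mult_ac)
  qed
  then have "complex_of_real (sqrt (2 * pi) * X)
      = (CLBINT t:{t. \<bar>t\<bar> \<le> L}. W t * (char Q (t / sqrt n) - E t))
        + sqrt n * (CLBINT \<theta>:O'. F \<theta>) - (CLBINT t:{t. L < \<bar>t\<bar>}. W t * E t)" (is "_ = ?a + ?b - ?c")
    unfolding D[symmetric] using P G by (simp only: of_real_diff) simp
  then have "\<bar>sqrt (2 * pi) * X\<bar> = cmod (?a + ?b - ?c)"
    by (metis norm_of_real)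
  also have "\<dots> \<le> cmod ?a + cmod ?b + cmod ?c"
    by (meson add_mono_thms_linordered_semiring(3) norm_triangle_ineq norm_triangle_ineq4 order_trans)
  also have "\<dots> \<le> ?in + sqrt n * ?out + ?tail"
  proof (intro add_mono)
    show "cmod ?a \<le> ?in" using bound[of _ "\<lambda>t. W t * (char Q (t / sqrt n) - E t)"]
      by (simp add: norm_mult normW E_def)
    show "cmod ?b \<le> sqrt n * ?out" using bound[of O' F] sn
      by (simp add: norm_mult normF O'_def)
    show "cmod ?c \<le> ?tail" using bound[of _ "\<lambda>t. W t * E t"]
      by (simp add: norm_mult normW E_def)
  qed
  finally have "sqrt (2 * pi) * \<bar>X\<bar> \<le> ?in + sqrt n * ?out + ?tail"
    by (simp add: abs_mult)
  moreover have "1 * \<bar>X\<bar> \<le> sqrt (2 * pi) * \<bar>X\<bar>"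
    using pi_gt3 by (intro mult_right_mono) auto
  ultimately show ?thesis unfolding X_def by linarith
qed

lemma gauss_tail_tendsto_0:
  assumes "filterlim L at_top sequentially"
  shows "(\<lambda>n. LBINT t:{t. L n < \<bar>t\<bar>}. exp (- (t\<^sup>2 / 2))) \<longlonglongrightarrow> (0::real)"
proof -
  have "(\<lambda>n. LBINT t. indicator {t. L n < \<bar>t\<bar>} t *\<^sub>R exp (- (t\<^sup>2 / 2))) \<longlonglongrightarrow> (LBINT t::real. (0::real))"
  proof (rule integral_dominated_convergence[where w = "\<lambda>t. exp (- (t\<^sup>2 / 2))"])
    show "AE t in lborel. (\<lambda>n. indicator {t. L n < \<bar>t\<bar>} t *\<^sub>R exp (- (t\<^sup>2 / 2))) \<longlonglongrightarrow> (0::real)"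
    proof (rule AE_I2)
      fix t :: real
      have "\<forall>\<^sub>F n in sequentially. L n > \<bar>t\<bar>"
        using assms filterlim_at_top_dense by blast
      then have "\<forall>\<^sub>F n in sequentially. indicator {t. L n < \<bar>t\<bar>} t *\<^sub>R exp (- (t\<^sup>2 / 2)) = (0::real)"
        by eventually_elim simp
      then show "(\<lambda>n. indicator {t. L n < \<bar>t\<bar>} t *\<^sub>R exp (- (t\<^sup>2 / 2))) \<longlonglongrightarrow> (0::real)"
        by (rule tendsto_eventually)
    qed
  qed (auto simp: integrable_gauss indicator_def)
  then show ?thesis by (simp add: set_lebesgue_integral_def)
qed

section \<open>From expectations to almost sure limits\<close>

text \<open>
  Since \<open>iexp\<close> is Lipschitz with constant one, this follows from
  \<open>s U - t V = s (U - V) + (s - t) V\<close>. Two different frequencies are needed because the central limit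
  scaling changes with the time.
\<close>
lemma char_dist_le:
  assumes "prob_space N" and [measurable]: "U \<in> borel_measurable N" "V \<in> borel_measurable N"
    and UV: "(\<integral>\<^sup>+x. ennreal \<bar>U x - V x\<bar> \<partial>N) \<le> ennreal d" and "d \<ge> 0"
    and V: "(\<integral>\<^sup>+x. ennreal \<bar>V x\<bar> \<partial>N) \<le> ennreal e" and "e \<ge> 0"
  shows "cmod (char (distr N borel U) s - char (distr N borel V) t) \<le> \<bar>s\<bar> * d + \<bar>s - t\<bar> * e"
proof -
  interpret N: prob_space N by fact
  have le: "integrable N f \<and> (\<integral>x. \<bar>f x\<bar> \<partial>N) \<le> a"
    if "(\<integral>\<^sup>+x. ennreal \<bar>f x\<bar> \<partial>N) \<le> ennreal a" "a \<ge> 0" "f \<in> borel_measurable N" 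
    for f :: "_ \<Rightarrow> real" and a
  proof -
    have i: "integrable N f"
      using that by (intro integrableI_bounded) (auto simp: order.strict_trans1[OF that(1)])
    then have "(\<integral>\<^sup>+x. ennreal \<bar>f x\<bar> \<partial>N) = ennreal (\<integral>x. \<bar>f x\<bar> \<partial>N)"
      by (intro nn_integral_eq_integral) auto
    with that i show ?thesis by simp
  qed
  note UV' = le[OF UV \<open>d \<ge> 0\<close>] and V' = le[OF V \<open>e \<ge> 0\<close>]
  have lip: "cmod (iexp a - iexp b) \<le> \<bar>a - b\<bar>" for a b
  proof -
    have "iexp a - iexp b = iexp b * (iexp (a - b) - 1)"
      by (simp add: algebra_simps flip: exp_add)
    also have "cmod \<dots> = cmod (iexp (a - b) - (\<Sum>k\<le>0. (\<i> * (a - b))^k / fact k))"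
      by (simp add: norm_mult del: of_real_diff)
    also have "\<dots> \<le> \<bar>a - b\<bar>"
      using iexp_approx1[of "a - b" 0] by simp
    finally show ?thesis .
  qed
  have "char (distr N borel U) s - char (distr N borel V) t
      = (CLINT x|N. iexp (s * U x) - iexp (t * V x))"
    unfolding char_def
    by (subst Bochner_Integration.integral_diff) (auto simp: integral_distr intro!: N.integrable_iexp)
  also have "cmod \<dots> \<le> (\<integral>x. cmod (iexp (s * U x) - iexp (t * V x)) \<partial>N)"
    by (rule integral_norm_bound)
  also have "\<dots> \<le> (\<integral>x. \<bar>s\<bar> * \<bar>U x - V x\<bar> + \<bar>s - t\<bar> * \<bar>V x\<bar> \<partial>N)"
  proof (rule integral_mono)
    show "cmod (iexp (s * U x) - iexp (t * V x)) \<le> \<bar>s\<bar> * \<bar>U x - V x\<bar> + \<bar>s - t\<bar> * \<bar>V x\<bar>" for x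
    proof -
      have "\<bar>s * U x - t * V x\<bar> = \<bar>s * (U x - V x) + (s - t) * V x\<bar>" by (simp add: algebra_simps)
      also have "\<dots> \<le> \<bar>s\<bar> * \<bar>U x - V x\<bar> + \<bar>s - t\<bar> * \<bar>V x\<bar>"
        by (metis abs_mult abs_triangle_ineq)
      finally show ?thesis using lip[of "s * U x" "t * V x"] by linarith
    qed
    show "integrable N (\<lambda>x. cmod (iexp (s * U x) - iexp (t * V x)))"
      by (intro integrable_norm Bochner_Integration.integrable_diff N.integrable_iexp) auto
    show "integrable N (\<lambda>x. \<bar>s\<bar> * \<bar>U x - V x\<bar> + \<bar>s - t\<bar> * \<bar>V x\<bar>)"
      using UV' V' by auto
  qed
  also have "\<dots> = \<bar>s\<bar> * (\<integral>x. \<bar>U x - V x\<bar> \<partial>N) + \<bar>s - t\<bar> * (\<integral>x. \<bar>V x\<bar> \<partial>N)"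
    using UV' V' by (subst Bochner_Integration.integral_add) auto
  also have "\<dots> \<le> \<bar>s\<bar> * d + \<bar>s - t\<bar> * e"
    using UV' V' by (intro add_mono mult_left_mono) auto
  finally show ?thesis .
qed

text \<open>
  The form of the Borel-Cantelli argument used below: the sum of the \<open>g k\<close> has finite expectation, so it converges almost surely.
\<close>
lemma AE_tendsto_0_of_summable_expectations:
  fixes g :: "nat \<Rightarrow> 'a \<Rightarrow> real"
  assumes int: "\<And>k. integrable M (g k)" and nonneg: "\<And>k x. g k x \<ge> 0"
    and sum: "summable (\<lambda>k. \<integral>x. g k x \<partial>M)"
  shows "AE x in M. (\<lambda>k. g k x) \<longlonglongrightarrow> 0"
proof -
  have [measurable]: "g k \<in> borel_measurable M" for k using int by auto
  have "(\<integral>\<^sup>+x. (\<Sum>k. ennreal (g k x)) \<partial>M) = (\<Sum>k. \<integral>\<^sup>+x. ennreal (g k x) \<partial>M)"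
    by (rule nn_integral_suminf) simp
  also have "\<dots> = (\<Sum>k. ennreal (\<integral>x. g k x \<partial>M))"
    by (intro suminf_cong nn_integral_eq_integral int) (auto simp: nonneg)
  also have "\<dots> = ennreal (\<Sum>k. \<integral>x. g k x \<partial>M)"
    using sum by (intro suminf_ennreal2) (auto simp: nonneg)
  finally have "(\<integral>\<^sup>+x. (\<Sum>k. ennreal (g k x)) \<partial>M) \<noteq> \<infinity>" by simp
  then have "AE x in M. (\<Sum>k. ennreal (g k x)) \<noteq> \<infinity>"
    by (intro nn_integral_PInf_AE) auto
  then show ?thesis
  proof eventually_elim
    case (elim x)
    then have "summable (\<lambda>k. g k x)"
      by (intro summable_suminf_not_top) (auto simp: nonneg)
    then show ?case by (rule summable_LIMSEQ_zero)
  qed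
qed

section \<open>Characteristic functions of random distributions\<close>
lemma kernel_real_distribution:
  assumes "K \<in> M \<rightarrow>\<^sub>M prob_algebra borel" "\<omega> \<in> space M"
  shows "real_distribution (K \<omega>)"
proof -
  have "K \<omega> \<in> space (prob_algebra borel)" using assms by (rule measurable_space)
  then have "prob_space (K \<omega>)" "sets (K \<omega>) = sets borel" by (auto simp: space_prob_algebra)
  then show ?thesis
    by (simp add: real_distribution_def real_distribution_axioms_def)
qed

text \<open>
  Joint measurability in \<open>\<omega>\<close> and the frequency is what allows the expectation over \<open>\<omega>\<close> to be exchanged
  with frequency integrals. The integral of a parameter dependent function is written as the integral of a fixed
  function against the measure transported to the product with the parameter.
\<close>
lemma char_kernel_measurable:
  assumes K: "K \<in> M \<rightarrow>\<^sub>M prob_algebra borel"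
  shows "(\<lambda>z. char (K (fst z)) (snd z)) \<in> borel_measurable (M \<Otimes>\<^sub>M borel)"
proof -
  let ?N = "M \<Otimes>\<^sub>M (borel :: real measure)"
  let ?f = "\<lambda>z y. iexp (snd (z :: _ \<times> real) * y)"
  have [measurable]: "(\<lambda>z. K (fst z)) \<in> ?N \<rightarrow>\<^sub>M subprob_algebra borel"
    by (rule measurable_compose[OF measurable_fst measurable_prob_algebraD[OF K]])
  have D[measurable]: "(\<lambda>z. distr (K (fst z)) (?N \<Otimes>\<^sub>M borel) (Pair z)) \<in> ?N \<rightarrow>\<^sub>M subprob_algebra (?N \<Otimes>\<^sub>M borel)"
    by (rule measurable_distr2[where M=borel]) auto
  have f[measurable]: "(\<lambda>(z, y). ?f z y) \<in> borel_measurable (?N \<Otimes>\<^sub>M borel)" by measurable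
  have "(\<lambda>z. integral\<^sup>L (distr (K (fst z)) (?N \<Otimes>\<^sub>M borel) (Pair z)) (\<lambda>(z, y). ?f z y)) \<in> borel_measurable ?N"
    by measurable
  moreover have "integral\<^sup>L (distr (K (fst z)) (?N \<Otimes>\<^sub>M borel) (Pair z)) (\<lambda>(z, y). ?f z y) = char (K (fst z)) (snd z)"
    if z: "z \<in> space ?N" for z
  proof -
    have "fst z \<in> space M" using z by (auto simp: space_pair_measure)
    then have "sets (K (fst z)) = sets borel"
      using kernel_real_distribution[OF K] by (metis real_distribution.events_eq_borel)
    then have m: "Pair z \<in> K (fst z) \<rightarrow>\<^sub>M ?N \<Otimes>\<^sub>M borel"
      using z by (simp cong: measurable_cong_sets)
    show ?thesis unfolding char_def by (subst integral_distr[OF m f]) simp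
  qed
  ultimately show ?thesis by (subst measurable_cong[symmetric]) assumption+
qed

lemma tendsto_0_of_power2_le:
  fixes x y :: "nat \<Rightarrow> real"
  assumes "\<And>k. (x k)\<^sup>2 \<le> y k" "y \<longlonglongrightarrow> 0"
  shows "x \<longlonglongrightarrow> 0"
proof -
  have "(\<lambda>k. (x k)\<^sup>2) \<longlonglongrightarrow> 0"
    by (rule tendsto_sandwich[OF _ _ tendsto_const assms(2)]) (use assms in auto)
  then show ?thesis
    using tendsto_real_sqrt[of "\<lambda>k. (x k)\<^sup>2" 0] by (auto intro: tendsto_rabs_zero_cancel)
qed

text \<open>
  Beyond \<open>L / sqrt n\<close> with \<open>L = ln n / 2\<close> the Gaussian type bound gives \<open>E|\<phi>|\<^sup>2 \<le> C exp (- c (ln n)\<^sup>2 / 4)\<close>,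
  which decays faster than every power of \<open>n\<close>. Beyond \<open>\<delta>\<close> the bound \<open>O(n powr - b)\<close> survives
  the factor \<open>n\<close>, as \<open>1 - b < - 1\<close>.
\<close>
lemma outer_part_tendsto_0:
  fixes Q :: "nat \<Rightarrow> 'w \<Rightarrow> real measure"
  assumes M: "prob_space M" and Q: "\<And>n. Q n \<in> M \<rightarrow>\<^sub>M prob_algebra borel"
    and pos: "C > 0" "c > 0" "b > 2"
    and near: "\<And>\<theta> n. \<bar>\<theta>\<bar> \<le> \<delta> \<Longrightarrow> (\<integral>\<omega>. (cmod (char (Q n \<omega>) \<theta>))\<^sup>2 \<partial>M) \<le> C * exp (- (c * \<theta>\<^sup>2 * real n))"
    and far: "(\<lambda>n. LBINT \<theta>:{\<theta>. \<delta> \<le> \<bar>\<theta>\<bar> \<and> \<bar>\<theta>\<bar> \<le> pi}. (\<integral>\<omega>. (cmod (char (Q n \<omega>) \<theta>))\<^sup>2 \<partial>M))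
      \<in> O(\<lambda>n. real n powr (- b))"
  shows "AE \<omega> in M. (\<lambda>n. sqrt (real n) *
      (LBINT \<theta>:{\<theta>. ln (real n) / 2 / sqrt (real n) < \<bar>\<theta>\<bar> \<and> \<bar>\<theta>\<bar> \<le> pi}. cmod (char (Q n \<omega>) \<theta>))) \<longlonglongrightarrow> 0"
proof -
  interpret prob_space M by fact
  define S where "S n = {\<theta>. ln (real n) / 2 / sqrt (real n) < \<bar>\<theta>\<bar> \<and> \<bar>\<theta>\<bar> \<le> pi}" for n
  define F where "F = {\<theta>. \<delta> \<le> \<bar>\<theta>\<bar> \<and> \<bar>\<theta>\<bar> \<le> pi}"
  define \<phi> where "\<phi> n \<theta> = (\<integral>\<omega>. (cmod (char (Q n \<omega>) \<theta>))\<^sup>2 \<partial>M)" for n \<theta>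
  define g where "g n \<omega> = real n * (LBINT \<theta>:S n. (cmod (char (Q n \<omega>) \<theta>))\<^sup>2)" for n \<omega>
  have [measurable]: "S n \<in> sets borel" "F \<in> sets borel" for n 
    unfolding S_def F_def by measurable
  have S: "emeasure lborel (S n) \<le> ennreal (2 * pi)" "emeasure lborel (S n) < \<infinity>" 
    and fF: "emeasure lborel F < \<infinity>" for n
    using emeasure_subset_abs_le[of "S n" pi] emeasure_subset_abs_le(2)[of F pi] 
    by (auto simp: S_def F_def)
  have m: "(\<lambda>z. (cmod (char (Q n (fst z)) (snd z)))\<^sup>2) \<in> borel_measurable (M \<Otimes>\<^sub>M borel)" for n
    using char_kernel_measurable[OF Q] by measurable
  have b: "norm ((cmod (char (Q n \<omega>) \<theta>))\<^sup>2) \<le> 1" if "\<omega> \<in> space M" for n \<omega> \<theta>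
    using real_distribution.cmod_char_le_1[OF kernel_real_distribution[OF Q that]]
    by (simp add: power_le_one)
  have fub: "integrable M (\<lambda>\<omega>. LBINT \<theta>:B. (cmod (char (Q n \<omega>) \<theta>))\<^sup>2)"
    "set_integrable lborel B (\<lambda>\<theta>. \<integral>\<omega>. (cmod (char (Q n \<omega>) \<theta>))\<^sup>2 \<partial>M)"
    "(LBINT \<theta>:B. (\<integral>\<omega>. (cmod (char (Q n \<omega>) \<theta>))\<^sup>2 \<partial>M))
      = (\<integral>\<omega>. (LBINT \<theta>:B. (cmod (char (Q n \<omega>) \<theta>))\<^sup>2) \<partial>M)"
    if "B \<in> sets borel" "emeasure lborel B < \<infinity>" for B n
    using fubini_bounded_set_integral[OF M m[of n], of 1 B] b that by simp_all
  have \<phi>_int: "set_integrable lborel B (\<phi> n)" if "B \<in> sets borel" "emeasure lborel B < \<infinity>" for B n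
    using fub(2)[of "B" n] that by (simp add: \<phi>_def[abs_def])
  have \<phi>_nonneg: "\<phi> n \<theta> \<ge> 0" for n \<theta> unfolding \<phi>_def by simp
  have g_int: "integrable M (g n)" for n
    using fub(1)[of "S n" n] S by (simp add: g_def[abs_def])
  have g_nonneg: "g n \<omega> \<ge> 0" for n \<omega>
    by (simp add: g_def set_lebesgue_integral_def)
  have Eg: "(\<integral>\<omega>. g n \<omega> \<partial>M) = real n * (LBINT \<theta>:S n. \<phi> n \<theta>)" for n
    using fub(3)[of "S n" n] S by (simp add: g_def \<phi>_def)
  obtain K where K: "\<forall>\<^sub>F n in sequentially. norm (LBINT \<theta>:F. \<phi> n \<theta>) \<le> K * norm (real n powr (- b))"
    using far unfolding F_def \<phi>_def by (elim landau_o.bigE)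
  have bound: "\<forall>\<^sub>F n in sequentially. norm (\<integral>\<omega>. g n \<omega> \<partial>M)
      \<le> real n * (2 * pi * (C * exp (- (c * (ln (real n) / 2)\<^sup>2)))) + K * real n powr (1 - b)"
    using K eventually_gt_at_top[of 0]
  proof eventually_elim
    case (elim n)
    let ?e = "C * exp (- (c * (ln (real n) / 2)\<^sup>2))"
    have "(LBINT \<theta>:S n. \<phi> n \<theta>) \<le> (LBINT \<theta>. indicator {\<theta>. \<bar>\<theta>\<bar> \<le> pi} \<theta> * ?e + indicator F \<theta> * \<phi> n \<theta>)"
      unfolding set_lebesgue_integral_def real_scaleR_def
    proof (rule integral_mono)
      fix \<theta>
      show "indicator (S n) \<theta> * \<phi> n \<theta> \<le> indicator {\<theta>. \<bar>\<theta>\<bar> \<le> pi} \<theta> * ?e + indicator F \<theta> * \<phi> n \<theta>"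
      proof (cases "\<theta> \<in> S n \<and> \<theta> \<notin> F")
        case True
        then have \<theta>: "\<bar>\<theta>\<bar> \<le> \<delta>" "\<bar>\<theta>\<bar> \<le> pi" "ln (real n) / 2 / sqrt (real n) < \<bar>\<theta>\<bar>"
          by (auto simp: S_def F_def)
        then have "ln (real n) / 2 \<le> \<bar>\<theta>\<bar> * sqrt (real n)"
          using elim by (simp add: field_simps)
        then have "(ln (real n) / 2)\<^sup>2 \<le> (\<bar>\<theta>\<bar> * sqrt (real n))\<^sup>2"
          using elim by (intro power_mono) auto
        also have "\<dots> = \<theta>\<^sup>2 * real n" by (simp add: power_mult_distrib)
        finally have "C * exp (- (c * \<theta>\<^sup>2 * real n)) \<le> ?e"
          using pos by (simp add: mult.assoc)
        with near[OF \<theta>(1), of n] have "\<phi> n \<theta> \<le> ?e" by (simp add: \<phi>_def)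
        with \<theta> True show ?thesis by simp
      next
        case False
        moreover have "?e \<ge> 0" using pos by simp
        ultimately show ?thesis using \<phi>_nonneg[of n \<theta>] by (auto simp: indicator_def)
      qed
    next
      show "integrable lborel (\<lambda>\<theta>. indicator (S n) \<theta> * \<phi> n \<theta>)"
        using \<phi>_int[of "S n" n] S by (simp add: set_integrable_def)
      have "integrable lborel (\<lambda>\<theta>. indicator {\<theta>. \<bar>\<theta>\<bar> \<le> pi} \<theta> * ?e)"
        using emeasure_subset_abs_le(2)[of "{\<theta>. \<bar>\<theta>\<bar> \<le> pi}" pi] 
        by (intro integrable_mult_left integrable_real_indicator) auto
      then show "integrable lborel (\<lambda>\<theta>. indicator {\<theta>. \<bar>\<theta>\<bar> \<le> pi} \<theta> * ?e + indicator F \<theta> * \<phi> n \<theta>)"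
        using \<phi>_int[of F n] fF by (auto simp: set_integrable_def)
    qed
    also have "\<dots> = (LBINT \<theta>. indicator {\<theta>. \<bar>\<theta>\<bar> \<le> pi} \<theta> * ?e) + (LBINT \<theta>:F. \<phi> n \<theta>)"
      unfolding set_lebesgue_integral_def real_scaleR_def
    proof (rule Bochner_Integration.integral_add)
      show "integrable lborel (\<lambda>\<theta>. indicator {\<theta>. \<bar>\<theta>\<bar> \<le> pi} \<theta> * ?e)"
        using emeasure_subset_abs_le(2)[of "{\<theta>. \<bar>\<theta>\<bar> \<le> pi}" pi] 
        by (intro integrable_mult_left integrable_real_indicator) auto
      show "integrable lborel (\<lambda>\<theta>. indicator F \<theta> * \<phi> n \<theta>)"
        using \<phi>_int[of F n] fF by (auto simp: set_integrable_def)
    qed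
    also have "(LBINT \<theta>. indicator {\<theta>. \<bar>\<theta>\<bar> \<le> pi} \<theta> * ?e) = 2 * pi * ?e"
    proof -
      have "{\<theta>::real. \<bar>\<theta>\<bar> \<le> pi} = {-pi..pi}" by auto
      then show ?thesis by simp
    qed
    also have "(LBINT \<theta>:F. \<phi> n \<theta>) \<le> K * real n powr (- b)"
      using elim by simp
    finally have "real n * (LBINT \<theta>:S n. \<phi> n \<theta>) \<le> real n * (2 * pi * ?e + K * real n powr (- b))"
      by (intro mult_left_mono) auto
    also have "\<dots> = real n * (2 * pi * ?e) + K * real n powr (1 - b)"
      using elim by (simp add: ring_distribs powr_diff powr_minus field_simps)
    finally have "(\<integral>\<omega>. g n \<omega> \<partial>M) \<le> real n * (2 * pi * ?e) + K * real n powr (1 - b)"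
      unfolding Eg .
    moreover have "(\<integral>\<omega>. g n \<omega> \<partial>M) \<ge> 0" using g_nonneg by simp
    ultimately show ?case by simp
  qed
  \<comment> \<open>The first summand is \<open>O(n powr - 2)\<close>: \<open>(ln n)\<^sup>2\<close> beats every multiple of \<open>ln n\<close>.\<close>
  have "summable (\<lambda>n. real n * (2 * pi * (C * exp (- (c * (ln (real n) / 2)\<^sup>2)))) + K * real n powr (1 - b))"
  proof (intro summable_add summable_mult)
    show "summable (\<lambda>n. real n powr (1 - b))"
      using pos by (simp add: summable_real_powr_iff)
    show "summable (\<lambda>n. real n * (2 * pi * (C * exp (- (c * (ln (real n) / 2)\<^sup>2)))))"
    proof (rule summable_comparison_test_bigo)
      show "summable (\<lambda>n. norm (real n powr (-2)))"
        by (simp add: summable_real_powr_iff)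
      show "(\<lambda>n. real n * (2 * pi * (C * exp (- (c * (ln (real n) / 2)\<^sup>2))))) \<in> O(\<lambda>n. real n powr (-2))"
        using pos by real_asymp
    qed
  qed
  with bound have "summable (\<lambda>n. \<integral>\<omega>. g n \<omega> \<partial>M)"
    by (rule summable_comparison_test_ev)
  then have "AE \<omega> in M. (\<lambda>n. g n \<omega>) \<longlonglongrightarrow> 0"
    by (intro AE_tendsto_0_of_summable_expectations g_int g_nonneg)
  then show ?thesis
    using AE_space
  proof eventually_elim
    case (elim \<omega>)
    interpret R: real_distribution "Q n \<omega>" for n
      using kernel_real_distribution[OF Q] elim by blast
    show ?case
      unfolding S_def[symmetric]
    proof (rule tendsto_0_of_power2_le)
      show "(\<lambda>n. 2 * pi * g n \<omega>) \<longlonglongrightarrow> 0"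
        using tendsto_mult_right_zero elim by blast
      fix n
      have "(LBINT \<theta>:S n. cmod (char (Q n \<omega>) \<theta>))\<^sup>2 \<le> 2 * pi * (LBINT \<theta>:S n. (cmod (char (Q n \<omega>) \<theta>))\<^sup>2)"
        using S by (intro set_integral_cauchy_schwarz set_integrable_bounded[where B=1])
          (auto simp: R.cmod_char_le_1 power_le_one)
      then show "(sqrt (real n) * (LBINT \<theta>:S n. cmod (char (Q n \<omega>) \<theta>)))\<^sup>2 \<le> 2 * pi * g n \<omega>"
        by (simp add: power_mult_distrib g_def mult_left_mono mult.left_commute)
    qed
  qed
qed

text \<open>
  The expectation of \<open>|\<phi>(t / sqrt n) - exp (- t\<^sup>2 / 2)|\<^sup>2\<close>, integrated over \<open>|t| \<le> ln n\<close>, is \<open>O(n powr - \<eta>)\<close>.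
  Cauchy-Schwarz costs a factor \<open>2 ln n\<close>, which is absorbed by \<open>n powr \<zeta>\<close>; along \<open>p\<close> the resulting
  bound is \<open>k powr (\<alpha> (\<zeta> - \<eta>))\<close>, which is summable.
\<close>
lemma inner_part_tendsto_0:
  fixes Q :: "nat \<Rightarrow> 'w \<Rightarrow> real measure" and p :: "nat \<Rightarrow> nat"
  assumes M: "prob_space M" and Q: "\<And>n. Q n \<in> M \<rightarrow>\<^sub>M prob_algebra borel"
    and \<phi>2: "(\<lambda>n. LBINT t:{t. \<bar>t\<bar> \<le> ln (real n)}.
        \<bar>(\<integral>\<omega>. (cmod (char (Q n \<omega>) (t / sqrt (real n))))\<^sup>2 \<partial>M) - exp (- t\<^sup>2)\<bar>) \<in> O(\<lambda>n. real n powr (- \<eta>))"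
    and \<phi>1: "(\<lambda>n. LBINT t:{t. \<bar>t\<bar> \<le> ln (real n)}.
        cmod ((\<integral>\<omega>. char (Q n \<omega>) (t / sqrt (real n)) \<partial>M) - complex_of_real (exp (- (t\<^sup>2 / 2)))))
        \<in> O(\<lambda>n. real n powr (- \<eta>))"
    and \<zeta>: "\<zeta> > 0" and \<alpha>: "\<alpha> > 0" "\<alpha> * (\<eta> - \<zeta>) > 1"
    and p: "\<And>k. real k powr \<alpha> \<le> real (p k)"
  shows "AE \<omega> in M. (\<lambda>k. LBINT t:{t. \<bar>t\<bar> \<le> ln (real (p k))}.
      cmod (char (Q (p k) \<omega>) (t / sqrt (real (p k))) - complex_of_real (exp (- (t\<^sup>2 / 2))))) \<longlonglongrightarrow> 0"
proof -
  interpret prob_space M by fact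
  define S where "S n = {t. \<bar>t\<bar> \<le> ln (real n)}" for n
  define E where "E t = complex_of_real (exp (- (t\<^sup>2 / 2)))" for t :: real
  define \<psi> where "\<psi> n \<omega> t = char (Q n \<omega>) (t / sqrt (real n))" for n \<omega> t
  define P1 where "P1 n t = (\<integral>\<omega>. \<psi> n \<omega> t \<partial>M)" for n t
  define P2 where "P2 n t = (\<integral>\<omega>. (cmod (\<psi> n \<omega> t))\<^sup>2 \<partial>M)" for n t
  define D where "D n \<omega> = (LBINT t:S n. (cmod (\<psi> n \<omega> t - E t))\<^sup>2)" for n \<omega>
  have [measurable]: "S n \<in> sets borel" "E \<in> borel_measurable borel" for n 
    unfolding S_def E_def by measurable
  have S: "emeasure lborel (S n) \<le> ennreal (2 * \<bar>ln (real n)\<bar>)" "emeasure lborel (S n) < \<infinity>" for n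
    using emeasure_subset_abs_le[of "S n" "ln (real n)"] by (auto simp: S_def)
  have m\<psi>[measurable]: "(\<lambda>z. \<psi> n (fst z) (snd z)) \<in> borel_measurable (M \<Otimes>\<^sub>M borel)" for n
  proof -
    have "(\<lambda>z. (fst z, snd z / sqrt (real n))) \<in> M \<Otimes>\<^sub>M borel \<rightarrow>\<^sub>M M \<Otimes>\<^sub>M borel" by measurable
    from measurable_compose[OF this char_kernel_measurable[OF Q]] show ?thesis
      by (simp add: \<psi>_def)
  qed
  have m\<psi>'[measurable]: "(\<lambda>\<omega>. \<psi> n \<omega> t) \<in> borel_measurable M" for n t
    using measurable_compose[OF measurable_Pair2'[of t borel M] m\<psi>] by simp
  have \<psi>1: "cmod (\<psi> n \<omega> t) \<le> 1" if "\<omega> \<in> space M" for n \<omega> t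
    using real_distribution.cmod_char_le_1[OF kernel_real_distribution[OF Q that]]
    by (simp add: \<psi>_def)
  have E1: "cmod (E t) \<le> 1" for t by (simp add: E_def)
  have b: "cmod (\<psi> n \<omega> t - E t) \<le> 2" if "\<omega> \<in> space M" for n \<omega> t
    using norm_triangle_ineq4[of "\<psi> n \<omega> t" "E t"] \<psi>1[OF that, of n t] E1[of t] by linarith
  have b2: "(cmod (\<psi> n \<omega> t - E t))\<^sup>2 \<le> 4" if "\<omega> \<in> space M" for n \<omega> t
    using power_mono[OF b[OF that, of n t], of 2] by simp
  have mD: "(\<lambda>z. (cmod (\<psi> n (fst z) (snd z) - E (snd z)))\<^sup>2) \<in> borel_measurable (M \<Otimes>\<^sub>M borel)" for n
    by measurable
  have fD: "integrable M (\<lambda>\<omega>. LBINT t:B. (cmod (\<psi> n \<omega> t - E t))\<^sup>2)"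
    "set_integrable lborel B (\<lambda>t. \<integral>\<omega>. (cmod (\<psi> n \<omega> t - E t))\<^sup>2 \<partial>M)"
    "(LBINT t:B. (\<integral>\<omega>. (cmod (\<psi> n \<omega> t - E t))\<^sup>2 \<partial>M))
      = (\<integral>\<omega>. (LBINT t:B. (cmod (\<psi> n \<omega> t - E t))\<^sup>2) \<partial>M)"
    if "B \<in> sets borel" "emeasure lborel B < \<infinity>" for B n
    using fubini_bounded_set_integral[OF M mD[of n], of 4 B] b2 that by simp_all
  have \<psi>2: "(cmod (\<psi> n \<omega> t))\<^sup>2 \<le> 1" if "\<omega> \<in> space M" for n \<omega> t
    using \<psi>1[OF that] by (simp add: power_le_one)
  have m2: "(\<lambda>z. (cmod (\<psi> n (fst z) (snd z)))\<^sup>2) \<in> borel_measurable (M \<Otimes>\<^sub>M borel)" for n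
    by measurable
  have f2: "set_integrable lborel B (\<lambda>t. P2 n t)"
    if "B \<in> sets borel" "emeasure lborel B < \<infinity>" for B n
    using fubini_bounded_set_integral(2)[OF M m2[of n], of 1 B] \<psi>2 that by (simp add: P2_def)
  have f1: "set_integrable lborel B (\<lambda>t. P1 n t)"
    if "B \<in> sets borel" "emeasure lborel B < \<infinity>" for B n
    using fubini_bounded_set_integral(2)[OF M m\<psi>[of n], of 1 B] \<psi>1 that by (simp add: P1_def)
  have iE: "set_integrable lborel (S n) E" for n
    using S by (intro set_integrable_bounded[where B=1]) (auto simp: E1)
  have iE2: "set_integrable lborel (S n) (\<lambda>t. exp (- t\<^sup>2))" for n
    using S by (intro set_integrable_bounded[where B=1]) auto
  have iP1: "set_integrable lborel (S n) (\<lambda>t. cmod (P1 n t - E t))" for n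
    using f1[of "S n" n] S by (intro set_integrable_norm set_integral_diff iE) auto
  have iP2: "set_integrable lborel (S n) (\<lambda>t. \<bar>P2 n t - exp (- t\<^sup>2)\<bar>)" for n
    using f2[of "S n" n] S by (intro set_integrable_abs set_integral_diff iE2) auto
  \<comment> \<open>Expanding the square uses only the first two moments of \<open>\<phi>\<close>. In the cross term the deviation of
    the first moment appears with the weight \<open>exp (- t\<^sup>2 / 2) \<le> 1\<close>.\<close>
  have pointwise: "(\<integral>\<omega>. (cmod (\<psi> n \<omega> t - E t))\<^sup>2 \<partial>M)
      \<le> \<bar>P2 n t - exp (- t\<^sup>2)\<bar> + 2 * cmod (P1 n t - E t)" for n t
  proof -
    have i1: "integrable M (\<lambda>\<omega>. \<psi> n \<omega> t)"
      by (rule integrable_const_bound[of _ 1]) (auto simp: \<psi>1)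
    have i2: "integrable M (\<lambda>\<omega>. (cmod (\<psi> n \<omega> t))\<^sup>2)"
      by (rule integrable_const_bound[of _ 1]) (auto simp: \<psi>2)
    let ?e = "exp (- (t\<^sup>2 / 2))"
    have ee: "?e * ?e = exp (- t\<^sup>2)"
      by (subst mult_exp_exp) (rule arg_cong[where f=exp], simp)
    have "(\<integral>\<omega>. (cmod (\<psi> n \<omega> t - E t))\<^sup>2 \<partial>M)
        = (\<integral>\<omega>. (cmod (\<psi> n \<omega> t))\<^sup>2 - 2 * ?e * Re (\<psi> n \<omega> t) + exp (- t\<^sup>2) \<partial>M)"
    proof (rule Bochner_Integration.integral_cong)
      show "(cmod (\<psi> n \<omega> t - E t))\<^sup>2 = (cmod (\<psi> n \<omega> t))\<^sup>2 - 2 * ?e * Re (\<psi> n \<omega> t) + exp (- t\<^sup>2)" for \<omega>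
      proof -
        have "(cmod (w - complex_of_real e))\<^sup>2 = (cmod w)\<^sup>2 - 2 * e * Re w + e * e" for w e
          unfolding cmod_power2 by (simp add: power2_eq_square algebra_simps)
        from this[of "\<psi> n \<omega> t" ?e] show ?thesis unfolding E_def ee .
      qed
    qed simp
    also have "\<dots> = P2 n t - 2 * ?e * Re (P1 n t) + exp (- t\<^sup>2)"
      using i1 i2 by (simp add: P1_def P2_def integrable_Re integral_Re prob_space)
    also have "\<dots> = (P2 n t - exp (- t\<^sup>2)) + 2 * (?e * Re (E t - P1 n t))"
      using ee by (simp add: E_def algebra_simps)
    also have "\<dots> \<le> \<bar>P2 n t - exp (- t\<^sup>2)\<bar> + 2 * (1 * cmod (P1 n t - E t))"
    proof (intro add_mono mult_left_mono)
      have "?e * Re (E t - P1 n t) \<le> ?e * cmod (E t - P1 n t)"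
        by (intro mult_left_mono complex_Re_le_cmod) auto
      also have "\<dots> \<le> 1 * cmod (E t - P1 n t)"
        by (intro mult_right_mono) auto
      finally show "?e * Re (E t - P1 n t) \<le> 1 * cmod (P1 n t - E t)" 
        by (simp add: norm_minus_commute)
    qed auto
    finally show ?thesis by simp
  qed
  have ED: "(\<integral>\<omega>. D n \<omega> \<partial>M) \<le> (LBINT t:S n. \<bar>P2 n t - exp (- t\<^sup>2)\<bar>) + 2 * (LBINT t:S n. cmod (P1 n t - E t))" for n
  proof -
    have "(\<integral>\<omega>. D n \<omega> \<partial>M) = (LBINT t:S n. (\<integral>\<omega>. (cmod (\<psi> n \<omega> t - E t))\<^sup>2 \<partial>M))"
      using fD(3)[of "S n" n] S by (simp add: D_def)
    also have "\<dots> \<le> (LBINT t:S n. \<bar>P2 n t - exp (- t\<^sup>2)\<bar> + 2 * cmod (P1 n t - E t))"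
    proof (rule set_integral_mono)
      show "set_integrable lborel (S n) (\<lambda>t. \<integral>\<omega>. (cmod (\<psi> n \<omega> t - E t))\<^sup>2 \<partial>M)"
        using fD(2)[of "S n" n] S by simp
      show "set_integrable lborel (S n) (\<lambda>t. \<bar>P2 n t - exp (- t\<^sup>2)\<bar> + 2 * cmod (P1 n t - E t))"
        by (intro set_integral_add iP2 set_integrable_mult_right iP1)
    qed (rule pointwise)
    also have "\<dots> = (LBINT t:S n. \<bar>P2 n t - exp (- t\<^sup>2)\<bar>) + (LBINT t:S n. 2 * cmod (P1 n t - E t))"
      by (intro set_integral_add iP2 set_integrable_mult_right iP1)
    finally show ?thesis by simp
  qed
  have "(\<lambda>n. (LBINT t:S n. \<bar>P2 n t - exp (- t\<^sup>2)\<bar>) + 2 * (LBINT t:S n. cmod (P1 n t - E t)))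
      \<in> O(\<lambda>n. real n powr (- \<eta>))"
    using \<phi>1 \<phi>2 unfolding P1_def P2_def \<psi>_def S_def E_def
    by (intro sum_in_bigo) auto
  then obtain K where K: "\<forall>\<^sub>F n in sequentially. norm ((LBINT t:S n. \<bar>P2 n t - exp (- t\<^sup>2)\<bar>)
      + 2 * (LBINT t:S n. cmod (P1 n t - E t))) \<le> K * norm (real n powr (- \<eta>))" and "K > 0"
    by (elim landau_o.bigE)
  have D_nonneg: "D n \<omega> \<ge> 0" for n \<omega> by (simp add: D_def set_lebesgue_integral_def)
  have D_int: "integrable M (D n)" for n
    using fD(1)[of "S n" n] S by (simp add: D_def[abs_def])
  have ln_nonneg: "ln (real n) \<ge> 0" for n by (cases "n = 0") auto
  define g where "g k \<omega> = ln (real (p k)) * D (p k) \<omega>" for k \<omega>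
  have "filterlim (\<lambda>k. real k powr \<alpha>) at_top sequentially" using \<alpha> by real_asymp
  then have "filterlim (\<lambda>k. real (p k)) at_top sequentially"
    by (rule filterlim_at_top_mono) (use p in auto)
  then have plim: "filterlim p at_top sequentially"
    using filterlim_sequentially_iff_filterlim_real by blast
  have neg: "\<zeta> - \<eta> < 0" using \<alpha> by (smt (verit) mult_nonneg_nonpos)
  have bound: "\<forall>\<^sub>F k in sequentially. norm (\<integral>\<omega>. g k \<omega> \<partial>M) \<le> (K / \<zeta>) * real k powr (\<alpha> * (\<zeta> - \<eta>))"
    using plim[unfolded filterlim_iff, rule_format, OF K]
      plim[unfolded filterlim_iff, rule_format, OF eventually_gt_at_top[of 0]] eventually_gt_at_top[of 0]
  proof eventually_elim
    case (elim k)
    define m where "m = p k"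
    have "(\<integral>\<omega>. g k \<omega> \<partial>M) = ln (real m) * (\<integral>\<omega>. D m \<omega> \<partial>M)"
      by (simp add: g_def m_def)
    also have "\<dots> \<le> ln (real m) * (K * real m powr (- \<eta>))"
      using ED[of m] elim ln_nonneg unfolding m_def
      by (intro mult_left_mono) auto
    also have "\<dots> \<le> (real m powr \<zeta> / \<zeta>) * (K * real m powr (- \<eta>))"
      using elim \<zeta> \<open>K > 0\<close> by (intro mult_right_mono ln_powr_bound) (auto simp: m_def)
    also have "\<dots> = (K / \<zeta>) * real m powr (\<zeta> - \<eta>)"
      using elim by (simp add: powr_diff powr_minus field_simps)
    also have "\<dots> \<le> (K / \<zeta>) * (real k powr \<alpha>) powr (\<zeta> - \<eta>)"
      using neg \<zeta> \<open>K > 0\<close> p[of k] elim by (intro mult_left_mono powr_mono2') (auto simp: m_def)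
    finally have "(\<integral>\<omega>. g k \<omega> \<partial>M) \<le> (K / \<zeta>) * real k powr (\<alpha> * (\<zeta> - \<eta>))"
      by (simp add: powr_powr)
    moreover have "(\<integral>\<omega>. g k \<omega> \<partial>M) \<ge> 0" using D_nonneg ln_nonneg by (simp add: g_def)
    ultimately show ?case by simp
  qed
  have "summable (\<lambda>k. (K / \<zeta>) * real k powr (\<alpha> * (\<zeta> - \<eta>)))"
    using \<alpha> by (intro summable_mult) (simp add: summable_real_powr_iff algebra_simps)
  with bound have "summable (\<lambda>k. \<integral>\<omega>. g k \<omega> \<partial>M)"
    by (rule summable_comparison_test_ev)
  then have "AE \<omega> in M. (\<lambda>k. g k \<omega>) \<longlonglongrightarrow> 0"
    by (intro AE_tendsto_0_of_summable_expectations) (auto simp: g_def D_nonneg ln_nonneg D_int)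
  then show ?thesis
    using AE_space
  proof eventually_elim
    case (elim \<omega>)
    have [measurable]: "\<psi> n \<omega> \<in> borel_measurable borel" for n
      using measurable_compose[OF measurable_Pair1'[of \<omega> M borel] m\<psi>] elim by simp
    show ?case
      unfolding S_def[symmetric] \<psi>_def[symmetric] E_def[symmetric]
    proof (rule tendsto_0_of_power2_le)
      show "(\<lambda>k. 2 * g k \<omega>) \<longlonglongrightarrow> 0"
        using tendsto_mult_right_zero elim by blast
      fix k
      have "(LBINT t:S (p k). cmod (\<psi> (p k) \<omega> t - E t))\<^sup>2
          \<le> 2 * \<bar>ln (real (p k))\<bar> * (LBINT t:S (p k). (cmod (\<psi> (p k) \<omega> t - E t))\<^sup>2)"
        using S b b2 elim 
        by (intro set_integral_cauchy_schwarz set_integrable_bounded[where B=2] set_integrable_bounded[where B=4]) auto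
      then show "(LBINT t:S (p k). cmod (\<psi> (p k) \<omega> t - E t))\<^sup>2 \<le> 2 * g k \<omega>"
        using ln_nonneg by (simp add: g_def D_def)
    qed
  qed
qed

section \<open>Interpolation along a power subsequence\<close>

text \<open>
  Bernoulli's inequality for real exponents. For \<open>\<alpha> < 1\<close> the slope one suffices, because the power of a number
  in \<open>[0, 1]\<close> decreases with the exponent; hence the maximum.
\<close>
lemma powr_ge_linear:
  fixes x \<alpha> :: real
  assumes "0 \<le> x" "x \<le> 1" "\<alpha> > 0"
  shows "(1 - x) powr \<alpha> \<ge> 1 - max 1 \<alpha> * x"
proof (cases "x = 1")
  case False
  define \<beta> where "\<beta> = max 1 \<alpha>"
  show ?thesis
  proof (cases "x = 0")
    case False
    with assms \<open>x \<noteq> 1\<close> have x: "0 < x" "x < 1" by auto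
    have "\<exists>z. z > 1 - x \<and> z < 1 \<and> 1 powr \<beta> - (1 - x) powr \<beta> = (1 - (1 - x)) * (\<beta> * z powr (\<beta> - 1))"
      using x by (intro MVT2) (auto intro!: derivative_eq_intros)
    then obtain z where z: "1 - x < z" "z < 1" "1 - (1 - x) powr \<beta> = x * (\<beta> * z powr (\<beta> - 1))"
      by auto
    have "z powr (\<beta> - 1) \<le> 1" using z x by (intro powr_le1) (auto simp: \<beta>_def)
    then have "x * (\<beta> * z powr (\<beta> - 1)) \<le> x * (\<beta> * 1)"
      using x by (intro mult_left_mono) (auto simp: \<beta>_def)
    then have "1 - (1 - x) powr \<beta> \<le> x * \<beta>" by (simp only: z(3) mult_1_right)
    then have "1 - \<beta> * x \<le> (1 - x) powr \<beta>" by (simp add: algebra_simps)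
    also have "\<dots> \<le> (1 - x) powr \<alpha>"
      using x by (intro powr_mono') (auto simp: \<beta>_def)
    finally show ?thesis by (simp add: \<beta>_def)
  qed simp
qed simp

text \<open>
  The number \<open>m\<close> is the term of the sequence \<open>\<lceil>k powr \<alpha>\<rceil>\<close> with \<open>k = \<lfloor>n powr (1/\<alpha>)\<rfloor>\<close>. With
  \<open>y = n powr (1/\<alpha>)\<close>, the bound \<open>k \<ge> y - 1\<close> gives \<open>k powr \<alpha> \<ge> n (1 - 1/y) powr \<alpha>\<close>, and the previous lemma applies.
\<close>
lemma power_subsequence_gap:
  fixes \<alpha> :: real and n :: nat
  assumes "\<alpha> > 0" "n \<ge> 1"
  defines "m \<equiv> nat \<lceil>real (nat \<lfloor>real n powr (1 / \<alpha>)\<rfloor>) powr \<alpha>\<rceil>"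
  shows "m \<le> n" "real (n - m) \<le> max 1 \<alpha> * real n powr (1 - 1 / \<alpha>)"
proof -
  define y where "y = real n powr (1 / \<alpha>)"
  define k where "k = nat \<lfloor>y\<rfloor>"
  have y: "y \<ge> 1" using assms by (simp add: y_def ge_one_powr_ge_zero)
  have k: "real k \<le> y" "y - 1 \<le> real k" using y by (simp_all add: k_def)
  have yn: "y powr \<alpha> = real n" using assms by (simp add: y_def powr_powr)
  have m: "m = nat \<lceil>real k powr \<alpha>\<rceil>" by (simp add: m_def k_def y_def)
  have "real k powr \<alpha> \<le> real n" 
    using powr_mono2[of \<alpha> "real k" y] k assms by (simp add: yn)
  then show mn: "m \<le> n" by (simp add: m nat_le_iff ceiling_le_iff)
  have "real m \<ge> real k powr \<alpha>" by (simp add: m real_nat_ceiling_ge)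
  also have "real k powr \<alpha> \<ge> (y - 1) powr \<alpha>"
    using k y assms by (intro powr_mono2) auto
  also have "(y - 1) powr \<alpha> = (y * (1 - 1 / y)) powr \<alpha>"
    using y by (intro arg_cong[where f="\<lambda>u. u powr \<alpha>"]) (simp add: right_diff_distrib)
  also have "\<dots> = real n * (1 - 1 / y) powr \<alpha>"
    using y by (subst powr_mult) (auto simp: yn)
  also have "\<dots> \<ge> real n * (1 - max 1 \<alpha> * (1 / y))"
    using y assms by (intro mult_left_mono powr_ge_linear) auto
  finally have "real n - real m \<le> max 1 \<alpha> * (real n * (1 / y))"
    by (simp add: algebra_simps)
  also have "real n * (1 / y) = real n powr (1 - 1 / \<alpha>)"
    using assms by (simp add: y_def powr_diff)
  finally show "real (n - m) \<le> max 1 \<alpha> * real n powr (1 - 1 / \<alpha>)"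
    using mn by (simp add: of_nat_diff)
qed

text \<open>
  The two terms of the hypothesis on differences of characteristic functions correspond to the increment
  of the sum between the times \<open>m \<le> n\<close> and to the change of scale from \<open>sqrt m\<close> to \<open>sqrt n\<close>. With
  \<open>n - m = O(n powr (1 - 1/\<alpha>))\<close> they are, after normalisation, \<open>|t|\<close> times
  \<open>O(n powr (\<delta>0/2 - 1/(2\<alpha>)))\<close> and \<open>O(n powr (\<delta>0/2 - 1/\<alpha>))\<close>.
  The range \<open>|t| \<le> ln n / 2\<close> is half as long as the one known along the sequence, so that it is contained
  in \<open>|t| \<le> ln m\<close> as soon as \<open>m \<ge> sqrt n\<close>.
\<close>
lemma inner_part_interpolation:
  fixes R :: "nat \<Rightarrow> real measure"
  assumes R: "\<And>n. real_distribution (R n)"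
    and \<alpha>: "\<alpha> > 0" and \<delta>0: "0 \<le> \<delta>0" "\<delta>0 < 1 / \<alpha>" and "K \<ge> 0"
    and lip: "\<And>n k s t. k < n \<Longrightarrow> cmod (char (R n) s - char (R k) t)
        \<le> \<bar>s\<bar> * (K * real n powr (\<delta>0 / 2) * real (n - k) powr (1 / 2))
          + \<bar>s - t\<bar> * (K * real k powr (\<delta>0 / 2) * real k powr (1 / 2))"
    and p: "\<And>k. p k = nat \<lceil>real k powr \<alpha>\<rceil>"
    and sub: "(\<lambda>k. LBINT t:{t. \<bar>t\<bar> \<le> ln (real (p k))}.
      cmod (char (R (p k)) (t / sqrt (real (p k))) - complex_of_real (exp (- (t\<^sup>2 / 2))))) \<longlonglongrightarrow> 0"
      (is "?J \<longlonglongrightarrow> 0")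
  shows "(\<lambda>n. LBINT t:{t. \<bar>t\<bar> \<le> ln (real n) / 2}.
      cmod (char (R n) (t / sqrt (real n)) - complex_of_real (exp (- (t\<^sup>2 / 2))))) \<longlonglongrightarrow> 0"
      (is "?I \<longlonglongrightarrow> 0")
proof -
  interpret R: real_distribution "R n" for n by (rule R)
  define \<beta> where "\<beta> = max 1 \<alpha>"
  define \<kappa> where "\<kappa> = (1 / \<alpha> - \<delta>0) / 2"
  define E where "E t = complex_of_real (exp (- (t\<^sup>2 / 2)))" for t :: real
  define \<psi> where "\<psi> n t = char (R n) (t / sqrt (real n))" for n t
  define B where "B n = K * (sqrt \<beta> + \<beta>) * real n powr (- \<kappa>)" for n
  define q where "q n = nat \<lfloor>real n powr (1 / \<alpha>)\<rfloor>" for n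
  have \<kappa>: "\<kappa> > 0" using \<delta>0 by (simp add: \<kappa>_def)
  have \<beta>: "\<beta> \<ge> 1" by (simp add: \<beta>_def)
  have gap: "p (q n) \<le> n" "real (n - p (q n)) \<le> \<beta> * real n powr (1 - 1 / \<alpha>)" if "n \<ge> 1" for n
    using power_subsequence_gap[OF \<alpha> that] by (simp_all add: p q_def \<beta>_def)
  have [measurable]: "E \<in> borel_measurable borel" "\<psi> n \<in> borel_measurable borel" for n
    unfolding E_def \<psi>_def by measurable
  have \<psi>1: "cmod (\<psi> n t) \<le> 1" for n t unfolding \<psi>_def by (rule R.cmod_char_le_1)
  have E1: "cmod (E t) \<le> 1" for t by (simp add: E_def)
  have b: "cmod (\<psi> n t - E t) \<le> 2" for n t
    using norm_triangle_ineq4[of "\<psi> n t" "E t"] \<psi>1[of n t] E1[of t] by linarith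
  have int: "set_integrable lborel {t. \<bar>t\<bar> \<le> L} (\<lambda>t. cmod (\<psi> n t - E t))" for n and L :: real
    using b emeasure_subset_abs_le(2)[of "{t. \<bar>t\<bar> \<le> L}" L]
    by (intro set_integrable_bounded[where B=2]) auto
  have compare: "cmod (\<psi> n t - \<psi> m t) \<le> \<bar>t\<bar> * B n"
    if n: "n \<ge> 1" and m: "m \<ge> 1" "m \<le> n" "real (n - m) \<le> \<beta> * real n powr (1 - 1 / \<alpha>)" for n m t
  proof (cases "m = n")
    case True
    then show ?thesis using \<open>K \<ge> 0\<close> \<beta> by (simp add: B_def)
  next
    case False
    then have "m < n" using m by simp
    define D where "D = real (n - m)"
    have D: "D = real n - real m" using m by (simp add: D_def of_nat_diff)
    have pos: "real n > 0" "real m > 0" using n m by auto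
    \<comment> \<open>The normalised increment of the sum.\<close>
    have p1: "D powr (1 / 2) / sqrt (real n) \<le> sqrt \<beta> * real n powr (- (1 / \<alpha>) / 2)"
    proof -
      have "D powr (1 / 2) \<le> (\<beta> * real n powr (1 - 1 / \<alpha>)) powr (1 / 2)"
        using m(3) unfolding D_def by (intro powr_mono2) auto
      also have "\<dots> = sqrt \<beta> * real n powr ((1 - 1 / \<alpha>) / 2)"
        using \<beta> by (simp add: powr_mult powr_powr powr_half_sqrt)
      finally have "D powr (1 / 2) / sqrt (real n) \<le> sqrt \<beta> * (real n powr ((1 - 1 / \<alpha>) / 2) / sqrt (real n))"
        using pos by (simp add: divide_right_mono)
      also have "real n powr ((1 - 1 / \<alpha>) / 2) / sqrt (real n) = real n powr ((1 - 1 / \<alpha>) / 2 - 1 / 2)"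
        by (simp add: powr_diff powr_half_sqrt)
      also have "(1 - 1 / \<alpha>) / 2 - 1 / 2 = - (1 / \<alpha>) / 2" by (simp add: field_simps)
      finally show ?thesis .
    qed
    \<comment> \<open>The change of scale, estimated by \<open>x \<le> sqrt x\<close> for \<open>x = m / n \<le> 1\<close>.\<close>
    have p2: "(1 / sqrt (real m) - 1 / sqrt (real n)) * sqrt (real m) \<le> \<beta> * real n powr (- (1 / \<alpha>))"
    proof -
      have "(1 / sqrt (real m) - 1 / sqrt (real n)) * sqrt (real m) = 1 - sqrt (real m / real n)"
        using pos by (simp add: real_sqrt_divide field_simps)
      also have "\<dots> \<le> 1 - real m / real n"
      proof -
        have "(real m / real n)\<^sup>2 \<le> real m / real n"
          using m pos by (simp add: power2_eq_square field_simps)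
        then have "real m / real n \<le> sqrt (real m / real n)"
          by (rule real_le_rsqrt)
        then show ?thesis by simp
      qed
      also have "\<dots> = D / real n" using pos by (simp add: D field_simps)
      also have "\<dots> \<le> (\<beta> * real n powr (1 - 1 / \<alpha>)) / real n"
        using m(3) unfolding D_def by (intro divide_right_mono) auto
      also have "\<dots> = \<beta> * real n powr (- (1 / \<alpha>))"
        using pos by (simp add: powr_diff powr_minus field_simps)
      finally show ?thesis .
    qed
    have sgn: "1 / sqrt (real m) - 1 / sqrt (real n) \<ge> 0"
      using m pos by (simp add: frac_le)
    have e1: "real n powr (\<delta>0 / 2) * real n powr (- (1 / \<alpha>) / 2) = real n powr (- \<kappa>)"
      by (simp add: \<kappa>_def diff_divide_distrib flip: powr_add)
    have e2: "real n powr (\<delta>0 / 2) * real n powr (- (1 / \<alpha>)) \<le> real n powr (- \<kappa>)"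
    proof -
      have "real n powr (- (1 / \<alpha>)) \<le> real n powr (- (1 / \<alpha>) / 2)"
        using n \<alpha> by (intro powr_mono) (auto simp: field_simps)
      then show ?thesis unfolding e1[symmetric] by (intro mult_left_mono) auto
    qed
    have "cmod (\<psi> n t - \<psi> m t)
        \<le> \<bar>t / sqrt (real n)\<bar> * (K * real n powr (\<delta>0 / 2) * D powr (1 / 2))
          + \<bar>t / sqrt (real n) - t / sqrt (real m)\<bar> * (K * real m powr (\<delta>0 / 2) * real m powr (1 / 2))"
      unfolding \<psi>_def D_def by (rule lip) fact
    also have "\<bar>t / sqrt (real n) - t / sqrt (real m)\<bar> = \<bar>t\<bar> * (1 / sqrt (real m) - 1 / sqrt (real n))"
    proof -
      have "t / sqrt (real n) - t / sqrt (real m) = - (t * (1 / sqrt (real m) - 1 / sqrt (real n)))"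
        by (simp add: algebra_simps)
      then show ?thesis using sgn by (simp only: abs_minus_cancel abs_mult abs_of_nonneg[OF sgn])
    qed
    also have "\<bar>t / sqrt (real n)\<bar> * (K * real n powr (\<delta>0 / 2) * D powr (1 / 2))
      = \<bar>t\<bar> * K * (real n powr (\<delta>0 / 2) * (D powr (1 / 2) / sqrt (real n)))"
      by (simp add: abs_divide)
    also have "\<bar>t\<bar> * (1 / sqrt (real m) - 1 / sqrt (real n)) * (K * real m powr (\<delta>0 / 2) * real m powr (1 / 2))
      = \<bar>t\<bar> * K * (real m powr (\<delta>0 / 2) * ((1 / sqrt (real m) - 1 / sqrt (real n)) * sqrt (real m)))"
      by (simp add: powr_half_sqrt)
    also have "\<bar>t\<bar> * K * (real n powr (\<delta>0 / 2) * (D powr (1 / 2) / sqrt (real n)))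
        + \<bar>t\<bar> * K * (real m powr (\<delta>0 / 2) * ((1 / sqrt (real m) - 1 / sqrt (real n)) * sqrt (real m)))
      \<le> \<bar>t\<bar> * K * (real n powr (\<delta>0 / 2) * (sqrt \<beta> * real n powr (- (1 / \<alpha>) / 2)))
        + \<bar>t\<bar> * K * (real n powr (\<delta>0 / 2) * (\<beta> * real n powr (- (1 / \<alpha>))))"
    proof (intro add_mono mult_left_mono[of _ _ "\<bar>t\<bar> * K"])
      show "real n powr (\<delta>0 / 2) * (D powr (1 / 2) / sqrt (real n))
          \<le> real n powr (\<delta>0 / 2) * (sqrt \<beta> * real n powr (- (1 / \<alpha>) / 2))"
        by (rule mult_left_mono[OF p1]) simp
      show "real m powr (\<delta>0 / 2) * ((1 / sqrt (real m) - 1 / sqrt (real n)) * sqrt (real m))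
          \<le> real n powr (\<delta>0 / 2) * (\<beta> * real n powr (- (1 / \<alpha>)))"
        by (rule mult_mono[OF _ p2]) (use sgn m \<delta>0 in \<open>auto intro!: powr_mono2 mult_nonneg_nonneg\<close>)
    qed (use \<open>K \<ge> 0\<close> in auto)
    also have "\<dots> = \<bar>t\<bar> * K * (sqrt \<beta> * (real n powr (\<delta>0 / 2) * real n powr (- (1 / \<alpha>) / 2))
        + \<beta> * (real n powr (\<delta>0 / 2) * real n powr (- (1 / \<alpha>))))"
      by (simp add: algebra_simps)
    also have "\<dots> \<le> \<bar>t\<bar> * K * (sqrt \<beta> * real n powr (- \<kappa>) + \<beta> * real n powr (- \<kappa>))"
      using e1 e2 \<open>K \<ge> 0\<close> \<beta> by (intro mult_left_mono add_mono) auto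
    also have "\<dots> = \<bar>t\<bar> * B n" by (simp add: B_def algebra_simps)
    finally show ?thesis .
  qed
  have qlim: "filterlim q at_top sequentially"
  proof -
    have "filterlim (\<lambda>n. real n powr (1 / \<alpha>)) at_top sequentially" using \<alpha> by real_asymp
    then show ?thesis
      unfolding q_def
      by (intro filterlim_compose[OF filterlim_nat_sequentially] filterlim_compose[OF filterlim_floor_sequentially])
  qed
  have large: "\<forall>\<^sub>F n in sequentially. sqrt (real n) \<le> real (p (q n))"
  proof -
    have a: "\<forall>\<^sub>F n in sequentially. \<beta> * real n powr (1 - 1 / \<alpha>) \<le> real n / 2"
      using \<alpha> \<beta> by real_asymp
    have b: "\<forall>\<^sub>F n in sequentially. sqrt (real n) \<le> real n / 2"
      by real_asymp
    show ?thesis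
      using a b eventually_ge_at_top[of 1]
    proof eventually_elim
      case (elim n)
      then show ?case using gap[of n] by (simp add: of_nat_diff)
    qed
  qed
  have main: "\<forall>\<^sub>F n in sequentially. norm (?I n) \<le> ?J (q n) + ln (real n) * (ln (real n) / 2 * B n)"
    using large eventually_ge_at_top[of 1]
  proof eventually_elim
    case (elim n)
    define m where "m = p (q n)"
    define L where "L = ln (real n) / 2"
    have L: "L \<ge> 0" using elim by (simp add: L_def)
    have "real (p (q n)) \<ge> 1" using elim real_sqrt_ge_1_iff[of "real n"] by linarith
    then have m: "m \<ge> 1" "m \<le> n" "real (n - m) \<le> \<beta> * real n powr (1 - 1 / \<alpha>)"
      using elim gap[of n] by (auto simp: m_def)
    have "L = ln (sqrt (real n))" using elim by (simp add: L_def ln_sqrt)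
    also have "\<dots> \<le> ln (real m)" using elim m by (simp add: m_def)
    finally have Lm: "L \<le> ln (real m)" .
    have B0: "B n \<ge> 0" using \<open>K \<ge> 0\<close> \<beta> by (simp add: B_def)
    have c: "set_integrable lborel {t. \<bar>t\<bar> \<le> L} (\<lambda>t. L * B n)"
      using emeasure_subset_abs_le(2)[of "{t. \<bar>t\<bar> \<le> L}" L]
      by (intro set_integrable_bounded[where B="norm (L * B n)"]) auto
    have "?I n = (LBINT t:{t. \<bar>t\<bar> \<le> L}. cmod (\<psi> n t - E t))"
      by (simp add: \<psi>_def E_def L_def)
    also have "\<dots> \<le> (LBINT t:{t. \<bar>t\<bar> \<le> L}. cmod (\<psi> m t - E t) + L * B n)"
    proof (rule set_integral_mono)
      fix t assume "t \<in> {t. \<bar>t\<bar> \<le> L}"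
      then have "\<bar>t\<bar> * B n \<le> L * B n" using B0 by (intro mult_right_mono) auto
      then have "cmod (\<psi> n t - \<psi> m t) \<le> L * B n"
        using compare[OF elim(2) m, of t] by linarith
      then show "cmod (\<psi> n t - E t) \<le> cmod (\<psi> m t - E t) + L * B n"
        using norm_triangle_ineq[of "\<psi> n t - \<psi> m t" "\<psi> m t - E t"] by simp
    qed (intro int set_integral_add c)+
    also have "\<dots> = (LBINT t:{t. \<bar>t\<bar> \<le> L}. cmod (\<psi> m t - E t)) + (LBINT t:{t. \<bar>t\<bar> \<le> L}. L * B n)"
      by (intro set_integral_add int c)
    also have "(LBINT t:{t. \<bar>t\<bar> \<le> L}. L * B n) = ln (real n) * (ln (real n) / 2 * B n)"
    proof -
      have "{t. \<bar>t\<bar> \<le> L} = {-L..L}" by auto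
      then show ?thesis using L by (simp add: set_lebesgue_integral_def L_def)
    qed
    also have "(LBINT t:{t. \<bar>t\<bar> \<le> L}. cmod (\<psi> m t - E t)) \<le> (LBINT t:{t. \<bar>t\<bar> \<le> ln (real m)}. cmod (\<psi> m t - E t))"
      using Lm int[of L m] int[of "ln (real m)" m] unfolding set_lebesgue_integral_def set_integrable_def
      by (intro integral_mono) (auto simp: indicator_def)
    also have "\<dots> = ?J (q n)" by (simp add: \<psi>_def E_def m_def)
    finally have "?I n \<le> ?J (q n) + ln (real n) * (ln (real n) / 2 * B n)" by simp
    moreover have "?I n \<ge> 0" by (simp add: set_lebesgue_integral_def)
    ultimately show ?case by simp
  qed
  have "(\<lambda>n. ln (real n) * (ln (real n) / 2 * real n powr (- \<kappa>))) \<longlonglongrightarrow> 0"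
    using \<kappa> by real_asymp
  then have "(\<lambda>n. K * (sqrt \<beta> + \<beta>) * (ln (real n) * (ln (real n) / 2 * real n powr (- \<kappa>)))) \<longlonglongrightarrow> 0"
    by (rule tendsto_mult_right_zero)
  then have "(\<lambda>n. ln (real n) * (ln (real n) / 2 * B n)) \<longlonglongrightarrow> 0"
    by (simp add: B_def mult_ac)
  then have "(\<lambda>n. ?J (q n) + ln (real n) * (ln (real n) / 2 * B n)) \<longlonglongrightarrow> 0"
    using tendsto_add_zero[OF filterlim_compose[OF sub qlim]] by simp
  with main show ?thesis by (rule Lim_null_comparison)
qed

section \<open>The fibred system\<close>
text \<open>
  Splitting into real and imaginary parts reduces this to integrals of bounded real functions.
\<close>
lemma complex_integral_bind:
  fixes f :: "'b \<Rightarrow> complex"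
  assumes "prob_space M" and N: "N \<in> M \<rightarrow>\<^sub>M subprob_algebra L"
    and prob: "\<And>x. x \<in> space M \<Longrightarrow> prob_space (N x)"
    and f[measurable]: "f \<in> borel_measurable L" and bound: "\<And>y. cmod (f y) \<le> B"
  shows "integral\<^sup>L (M \<bind> N) f = (\<integral>x. integral\<^sup>L (N x) f \<partial>M)"
proof -
  interpret M: prob_space M by fact
  have fin: "finite_measure M" by unfold_locales
  have mass: "AE x in M. emeasure (N x) (space (N x)) \<le> ennreal 1"
    using prob by (auto simp: prob_space.emeasure_space_1)
  have b: "\<bar>Re (f y)\<bar> \<le> B" "\<bar>Im (f y)\<bar> \<le> B" for y
    using bound[of y] abs_Re_le_cmod[of "f y"] abs_Im_le_cmod[of "f y"] by linarith+
  have mRe: "(\<lambda>y. Re (f y)) \<in> borel_measurable L" and mIm: "(\<lambda>y. Im (f y)) \<in> borel_measurable L"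
    by measurable
  note re = integrable_bind[OF mRe b(1) N fin mass] integral_bind[OF mRe b(1) N fin mass]
  note im = integrable_bind[OF mIm b(2) N fin mass] integral_bind[OF mIm b(2) N fin mass]
  have intN: "integrable (N x) f" if "x \<in> space M" for x
  proof -
    interpret prob_space "N x" by (rule prob[OF that])
    have "sets (N x) = sets L" using N that by (rule subprob_measurableD)
    then show ?thesis
      using f bound by (intro integrable_const_bound[of _ B]) (auto cong: measurable_cong_sets)
  qed
  have bN: "cmod (integral\<^sup>L (N x) f) \<le> B" if "x \<in> space M" for x
  proof -
    interpret prob_space "N x" by (rule prob[OF that])
    have "cmod (integral\<^sup>L (N x) f) \<le> (\<integral>y. cmod (f y) \<partial>N x)" by (rule integral_norm_bound)
    also have "\<dots> \<le> (\<integral>y. B \<partial>N x)"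
      using intN[OF that] bound by (intro integral_mono) auto
    finally show ?thesis by (simp add: prob_space)
  qed
  have mN: "(\<lambda>x. integral\<^sup>L (N x) f) \<in> borel_measurable M"
    by (rule measurable_compose[OF N]) measurable
  have iN: "integrable M (\<lambda>x. integral\<^sup>L (N x) f)"
    using bN mN by (intro M.integrable_const_bound[of _ B]) auto
  have i: "integrable (M \<bind> N) f"
  proof -
    have "integrable (M \<bind> N) (\<lambda>y. complex_of_real (Re (f y)) + \<i> * complex_of_real (Im (f y)))"
      using re(1) im(1) by auto
    then show ?thesis by (simp flip: complex_eq)
  qed
  show ?thesis
  proof (rule complex_eqI)
    have "Re (integral\<^sup>L (M \<bind> N) f) = (\<integral>x. (\<integral>y. Re (f y) \<partial>N x) \<partial>M)"
      using i re(2) by (simp add: integral_Re)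
    also have "\<dots> = (\<integral>x. Re (integral\<^sup>L (N x) f) \<partial>M)"
      by (intro Bochner_Integration.integral_cong) (auto simp: integral_Re intN)
    also have "\<dots> = Re (\<integral>x. integral\<^sup>L (N x) f \<partial>M)" using iN by (rule integral_Re)
    finally show "Re (integral\<^sup>L (M \<bind> N) f) = Re (\<integral>x. integral\<^sup>L (N x) f \<partial>M)" .
    have "Im (integral\<^sup>L (M \<bind> N) f) = (\<integral>x. (\<integral>y. Im (f y) \<partial>N x) \<partial>M)"
      using i im(2) by (simp add: integral_Im)
    also have "\<dots> = (\<integral>x. Im (integral\<^sup>L (N x) f) \<partial>M)"
      by (intro Bochner_Integration.integral_cong) (auto simp: integral_Im intN)
    also have "\<dots> = Im (\<integral>x. integral\<^sup>L (N x) f \<partial>M)" using iN by (rule integral_Im)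
    finally show "Im (integral\<^sup>L (M \<bind> N) f) = Im (\<integral>x. integral\<^sup>L (N x) f \<partial>M)" .
  qed
qed

context fibred_system
begin

abbreviation "total_space \<equiv> restrict_space (M \<Otimes>\<^sub>M X) (Sigma (space M) Xs)"

abbreviation "total_space2 \<equiv> restrict_space (M \<Otimes>\<^sub>M X \<Otimes>\<^sub>M X) (SIGMA \<omega>:space M. Xs \<omega> \<times> Xs \<omega>)"

lemma space_total_space: "space total_space = Sigma (space M) Xs"
  using sets.sets_into_space[OF total_space_measurable] by (auto simp: space_restrict_space)

lemma space_fibre: "\<omega> \<in> space M \<Longrightarrow> space (mu \<omega>) = Xs \<omega>"
  using sets_eq_imp_space_eq[OF fibre_measure_sets] fibre_subset
  by (auto simp: space_restrict_space)

lemma T_iter_space: "\<omega> \<in> space M \<Longrightarrow> (T ^^ j) \<omega> \<in> space M"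
  by (induction j) (auto intro: measurable_space[OF T_measurable])

lemma fibre_iter_in_fibre: "\<omega> \<in> space M \<Longrightarrow> x \<in> Xs \<omega> \<Longrightarrow> fibre_iter T f j \<omega> x \<in> Xs ((T ^^ j) \<omega>)"
  by (induction j) (use fibre_map T_iter_space in auto)

lemma fibre_iter_measurable:
  "(\<lambda>(\<omega>, x). ((T ^^ j) \<omega>, fibre_iter T f j \<omega> x)) \<in> total_space \<rightarrow>\<^sub>M total_space"
proof (induction j)
  case 0
  then show ?case by (simp add: case_prod_unfold)
next
  case (Suc j)
  from measurable_compose[OF this skew_measurable] show ?case
    by (simp add: case_prod_unfold)
qed

lemma birkhoff_measurable:
  assumes "A \<in> borel_measurable X"
  shows "(\<lambda>z. birkhoff T f A n (fst z) (snd z)) \<in> borel_measurable total_space"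
proof -
  have "(\<lambda>z. A (fibre_iter T f j (fst z) (snd z))) \<in> borel_measurable total_space" for j
  proof -
    have "snd \<in> total_space \<rightarrow>\<^sub>M X" by (rule measurable_restrict_space1) measurable
    from measurable_compose[OF measurable_compose[OF fibre_iter_measurable this] assms] show ?thesis
      by (simp add: case_prod_unfold)
  qed
  then show ?thesis unfolding birkhoff_def by measurable
qed

lemma fibre_inclusion_measurable:
  assumes "\<omega> \<in> space M" shows "(\<lambda>x. x) \<in> mu \<omega> \<rightarrow>\<^sub>M X"
  using measurable_restrict_space1[OF measurable_ident, of X "Xs \<omega>"]
  by (simp add: id_def cong: measurable_cong_sets[OF fibre_measure_sets[OF assms] refl])

lemma fibre_embedding_measurable:
  assumes "\<omega> \<in> space M" shows "Pair \<omega> \<in> mu \<omega> \<rightarrow>\<^sub>M total_space"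
proof (rule measurable_restrict_space2)
  show "Pair \<omega> \<in> space (mu \<omega>) \<rightarrow> Sigma (space M) Xs" using assms space_fibre by auto
  show "Pair \<omega> \<in> mu \<omega> \<rightarrow>\<^sub>M M \<Otimes>\<^sub>M X"
    using fibre_inclusion_measurable[OF assms] assms by measurable
qed

lemma fibre_embedding2_measurable:
  assumes "\<omega> \<in> space M" shows "Pair \<omega> \<in> mu \<omega> \<Otimes>\<^sub>M mu \<omega> \<rightarrow>\<^sub>M total_space2"
proof (rule measurable_restrict_space2)
  show "Pair \<omega> \<in> space (mu \<omega> \<Otimes>\<^sub>M mu \<omega>) \<rightarrow> (SIGMA \<omega>:space M. Xs \<omega> \<times> Xs \<omega>)" 
    using assms space_fibre by (auto simp: space_pair_measure)
  have "(\<lambda>z. (fst z, snd z)) \<in> mu \<omega> \<Otimes>\<^sub>M mu \<omega> \<rightarrow>\<^sub>M X \<Otimes>\<^sub>M X"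
    by (intro measurable_Pair measurable_compose[OF measurable_fst fibre_inclusion_measurable[OF assms]]
       measurable_compose[OF measurable_snd fibre_inclusion_measurable[OF assms]])
  then show "Pair \<omega> \<in> mu \<omega> \<Otimes>\<^sub>M mu \<omega> \<rightarrow>\<^sub>M M \<Otimes>\<^sub>M X \<Otimes>\<^sub>M X"
    using assms by (intro measurable_Pair) auto
qed

lemma birkhoff_fibre_measurable:
  assumes "A \<in> borel_measurable X" "\<omega> \<in> space M"
  shows "birkhoff T f A n \<omega> \<in> borel_measurable (mu \<omega>)"
  using measurable_compose[OF fibre_embedding_measurable[OF assms(2)] birkhoff_measurable[OF assms(1)]]
  by simp

text \<open>
  The law of \<open>S\<^sub>n\<close> on the fibre is a random distribution, to which the preceding results apply.
\<close>
lemma birkhoff_distr_measurable: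
  assumes A: "A \<in> borel_measurable X"
  shows "(\<lambda>\<omega>. distr (mu \<omega>) borel (birkhoff T f A n \<omega>)) \<in> M \<rightarrow>\<^sub>M prob_algebra borel"
proof (rule measurable_prob_algebraI)
  show p: "prob_space (distr (mu \<omega>) borel (birkhoff T f A n \<omega>))" if "\<omega> \<in> space M" for \<omega>
    using fibre_measure_prob[OF that] birkhoff_fibre_measurable[OF A that]
    by (rule prob_space.prob_space_distr)
  show "(\<lambda>\<omega>. distr (mu \<omega>) borel (birkhoff T f A n \<omega>)) \<in> M \<rightarrow>\<^sub>M subprob_algebra borel"
  proof (rule measurable_subprob_algebra)
    fix B :: "real set" assume B: "B \<in> sets borel"
    let ?B = "(\<lambda>z. birkhoff T f A n (fst z) (snd z)) -` B \<inter> space total_space"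
    have "(\<lambda>\<omega>. emeasure (mu \<omega>) (Pair \<omega> -` ?B)) \<in> borel_measurable M"
      by (intro fibre_measure_measurable measurable_sets[OF birkhoff_measurable[OF A] B])
    moreover have "emeasure (mu \<omega>) (Pair \<omega> -` ?B) = emeasure (distr (mu \<omega>) borel (birkhoff T f A n \<omega>)) B"
      if \<omega>: "\<omega> \<in> space M" for \<omega>
    proof -
      have "Pair \<omega> -` ?B = birkhoff T f A n \<omega> -` B \<inter> space (mu \<omega>)"
        using \<omega> by (auto simp: space_total_space space_fibre)
      then show ?thesis
        using birkhoff_fibre_measurable[OF A \<omega>] B by (simp add: emeasure_distr)
    qed
    ultimately show "(\<lambda>\<omega>. emeasure (distr (mu \<omega>) borel (birkhoff T f A n \<omega>)) B) \<in> borel_measurable M"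
      by (simp cong: measurable_cong)
  qed (auto intro: prob_space_imp_subprob_space p)
qed

lemma birkhoff_Ints:
  assumes "\<And>x. x \<in> space X \<Longrightarrow> A x \<in> \<int>" "\<omega> \<in> space M" "x \<in> Xs \<omega>"
  shows "birkhoff T f A n \<omega> x \<in> \<int>"
  unfolding birkhoff_def
  using assms fibre_iter_in_fibre[OF assms(2,3)] fibre_subset T_iter_space by (intro Ints_sum) blast

lemma muhat_kernel_measurable:
  "(\<lambda>\<omega>. distr (mu \<omega>) total_space (Pair \<omega>)) \<in> M \<rightarrow>\<^sub>M subprob_algebra total_space"
proof (rule measurable_subprob_algebra)
  show "subprob_space (distr (mu \<omega>) total_space (Pair \<omega>))" if "\<omega> \<in> space M" for \<omega>
    using prob_space.prob_space_distr[OF fibre_measure_prob[OF that] fibre_embedding_measurable[OF that]]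
    by (rule prob_space_imp_subprob_space)
  fix B assume B: "B \<in> sets total_space"
  have "emeasure (mu \<omega>) (Pair \<omega> -` B) = emeasure (distr (mu \<omega>) total_space (Pair \<omega>)) B"
    if \<omega>: "\<omega> \<in> space M" for \<omega>
  proof -
    have "Pair \<omega> -` B \<subseteq> space (mu \<omega>)"
      using sets.sets_into_space[OF B] \<omega> by (auto simp: space_total_space space_fibre)
    then show ?thesis
      by (simp add: emeasure_distr[OF fibre_embedding_measurable[OF \<omega>] B] Int_absorb2)
  qed
  with fibre_measure_measurable[OF B] 
  show "(\<lambda>\<omega>. emeasure (distr (mu \<omega>) total_space (Pair \<omega>)) B) \<in> borel_measurable M"
    by (simp cong: measurable_cong)
qed simp

lemma char_sum_eq:
  assumes A: "A \<in> borel_measurable X"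
  shows "char_sum M T X Xs f mu A n \<theta> = (\<integral>\<omega>. char (distr (mu \<omega>) borel (birkhoff T f A n \<omega>)) \<theta> \<partial>M)"
proof -
  let ?h = "\<lambda>z. iexp (\<theta> * birkhoff T f A n (fst z) (snd z))"
  have m: "?h \<in> borel_measurable total_space"
    using birkhoff_measurable[OF A] by measurable
  have "char_sum M T X Xs f mu A n \<theta> = (\<integral>\<omega>. integral\<^sup>L (distr (mu \<omega>) total_space (Pair \<omega>)) ?h \<partial>M)"
    unfolding char_sum_def muhat_def
  proof (rule complex_integral_bind[OF prob_space_axioms muhat_kernel_measurable _ m, of 1])
    show "prob_space (distr (mu \<omega>) total_space (Pair \<omega>))" if "\<omega> \<in> space M" for \<omega>
      using prob_space.prob_space_distr[OF fibre_measure_prob[OF that] fibre_embedding_measurable[OF that]] .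
  qed simp
  also have "\<dots> = (\<integral>\<omega>. char (distr (mu \<omega>) borel (birkhoff T f A n \<omega>)) \<theta> \<partial>M)"
  proof (rule Bochner_Integration.integral_cong)
    fix \<omega> assume \<omega>: "\<omega> \<in> space M"
    show "integral\<^sup>L (distr (mu \<omega>) total_space (Pair \<omega>)) ?h = char (distr (mu \<omega>) borel (birkhoff T f A n \<omega>)) \<theta>"
      unfolding char_def
      by (subst (1) integral_distr[OF fibre_embedding_measurable[OF \<omega>] m],
          subst integral_distr[OF birkhoff_fibre_measurable[OF A \<omega>]]) auto
  qed simp
  finally show ?thesis .
qed

text \<open>
  Pushing the fibre measures forward to \<open>X\<close> gives measures on one fixed space, whose products
  are known to depend measurably on \<open>\<omega>\<close>. This settles the product kernel on the fibre squares below.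
\<close>
lemma fibre_pushforward_measurable:
  "(\<lambda>\<omega>. distr (mu \<omega>) X (\<lambda>x. x)) \<in> M \<rightarrow>\<^sub>M subprob_algebra X"
proof (rule measurable_subprob_algebra)
  show "subprob_space (distr (mu \<omega>) X (\<lambda>x. x))" if "\<omega> \<in> space M" for \<omega>
    using prob_space.prob_space_distr[OF fibre_measure_prob[OF that] fibre_inclusion_measurable[OF that]]
    by (rule prob_space_imp_subprob_space)
  fix B assume B: "B \<in> sets X"
  let ?B = "snd -` B \<inter> space total_space"
  have "snd \<in> total_space \<rightarrow>\<^sub>M X" by (rule measurable_restrict_space1) measurable
  then have B': "?B \<in> sets total_space" using B by (rule measurable_sets)
  have "emeasure (mu \<omega>) (Pair \<omega> -` ?B) = emeasure (distr (mu \<omega>) X (\<lambda>x. x)) B"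
    if \<omega>: "\<omega> \<in> space M" for \<omega>
  proof -
    have "Pair \<omega> -` ?B = (\<lambda>x. x) -` B \<inter> space (mu \<omega>)"
      using \<omega> by (auto simp: space_total_space space_fibre)
    then show ?thesis
      by (simp add: emeasure_distr[OF fibre_inclusion_measurable[OF \<omega>] B])
  qed
  with fibre_measure_measurable[OF B'] 
  show "(\<lambda>\<omega>. emeasure (distr (mu \<omega>) X (\<lambda>x. x)) B) \<in> borel_measurable M"
    by (simp cong: measurable_cong)
qed simp

lemma total_space2_measurable: "(SIGMA \<omega>:space M. Xs \<omega> \<times> Xs \<omega>) \<in> sets (M \<Otimes>\<^sub>M X \<Otimes>\<^sub>M X)"
proof -
  have "(\<lambda>z. (fst z, fst (snd z))) -` Sigma (space M) Xs \<inter> space (M \<Otimes>\<^sub>M X \<Otimes>\<^sub>M X) \<in> sets (M \<Otimes>\<^sub>M X \<Otimes>\<^sub>M X)"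
    by (rule measurable_sets[OF _ total_space_measurable]) measurable
  moreover have "(\<lambda>z. (fst z, snd (snd z))) -` Sigma (space M) Xs \<inter> space (M \<Otimes>\<^sub>M X \<Otimes>\<^sub>M X) \<in> sets (M \<Otimes>\<^sub>M X \<Otimes>\<^sub>M X)"
    by (rule measurable_sets[OF _ total_space_measurable]) measurable
  ultimately have "((\<lambda>z. (fst z, fst (snd z))) -` Sigma (space M) Xs \<inter> space (M \<Otimes>\<^sub>M X \<Otimes>\<^sub>M X))
     \<inter> ((\<lambda>z. (fst z, snd (snd z))) -` Sigma (space M) Xs \<inter> space (M \<Otimes>\<^sub>M X \<Otimes>\<^sub>M X)) \<in> sets (M \<Otimes>\<^sub>M X \<Otimes>\<^sub>M X)"
    by (rule sets.Int)
  also have "((\<lambda>z. (fst z, fst (snd z))) -` Sigma (space M) Xs \<inter> space (M \<Otimes>\<^sub>M X \<Otimes>\<^sub>M X))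
     \<inter> ((\<lambda>z. (fst z, snd (snd z))) -` Sigma (space M) Xs \<inter> space (M \<Otimes>\<^sub>M X \<Otimes>\<^sub>M X))
     = (SIGMA \<omega>:space M. Xs \<omega> \<times> Xs \<omega>)"
    using fibre_subset by (auto simp: space_pair_measure)
  finally show ?thesis .
qed

lemma muhat2_kernel_measurable:
  "(\<lambda>\<omega>. distr (mu \<omega> \<Otimes>\<^sub>M mu \<omega>) total_space2 (Pair \<omega>)) \<in> M \<rightarrow>\<^sub>M subprob_algebra total_space2"
proof (rule measurable_subprob_algebra)
  have pp: "prob_space (mu \<omega> \<Otimes>\<^sub>M mu \<omega>)" if "\<omega> \<in> space M" for \<omega>
    using fibre_measure_prob[OF that] by (intro prob_space_pair)
  show "subprob_space (distr (mu \<omega> \<Otimes>\<^sub>M mu \<omega>) total_space2 (Pair \<omega>))" if "\<omega> \<in> space M" for \<omega>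
    using prob_space.prob_space_distr[OF pp[OF that] fibre_embedding2_measurable[OF that]]
    by (rule prob_space_imp_subprob_space)
  fix B assume B: "B \<in> sets total_space2"
  then have B': "B \<in> sets (M \<Otimes>\<^sub>M X \<Otimes>\<^sub>M X)" "B \<subseteq> (SIGMA \<omega>:space M. Xs \<omega> \<times> Xs \<omega>)"
    using total_space2_measurable sets.Int_space_eq2[OF total_space2_measurable]
    by (simp_all add: sets_restrict_space_iff)
  let ?nu = "\<lambda>\<omega>. distr (mu \<omega>) X (\<lambda>x. x)"
  have K: "(\<lambda>\<omega>. distr (?nu \<omega> \<Otimes>\<^sub>M ?nu \<omega>) (M \<Otimes>\<^sub>M X \<Otimes>\<^sub>M X) (Pair \<omega>)) \<in> M \<rightarrow>\<^sub>M subprob_algebra (M \<Otimes>\<^sub>M X \<Otimes>\<^sub>M X)"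
    by (rule measurable_distr2[where M="X \<Otimes>\<^sub>M X"])
      (auto intro!: measurable_pair_measure fibre_pushforward_measurable)
  have "(\<lambda>\<omega>. emeasure (distr (?nu \<omega> \<Otimes>\<^sub>M ?nu \<omega>) (M \<Otimes>\<^sub>M X \<Otimes>\<^sub>M X) (Pair \<omega>)) B) \<in> borel_measurable M"
    by (rule measurable_compose[OF K measurable_emeasure_subprob_algebra[OF B'(1)]])
  moreover have "emeasure (distr (?nu \<omega> \<Otimes>\<^sub>M ?nu \<omega>) (M \<Otimes>\<^sub>M X \<Otimes>\<^sub>M X) (Pair \<omega>)) B
      = emeasure (distr (mu \<omega> \<Otimes>\<^sub>M mu \<omega>) total_space2 (Pair \<omega>)) B"
    if \<omega>: "\<omega> \<in> space M" for \<omega>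
  proof -
    have inc: "(\<lambda>x. x) \<in> mu \<omega> \<rightarrow>\<^sub>M X" by (rule fibre_inclusion_measurable[OF \<omega>])
    have "prob_space (?nu \<omega>)"
      using fibre_measure_prob[OF \<omega>] inc by (rule prob_space.prob_space_distr)
    then have sf: "sigma_finite_measure (?nu \<omega>)"
      by (simp add: prob_space_imp_sigma_finite)
    have inc2: "(\<lambda>(x, y). (x, y)) \<in> mu \<omega> \<Otimes>\<^sub>M mu \<omega> \<rightarrow>\<^sub>M X \<Otimes>\<^sub>M X"
      unfolding case_prod_unfold
      by (intro measurable_Pair measurable_compose[OF measurable_fst inc] measurable_compose[OF measurable_snd inc])
    have nn: "?nu \<omega> \<Otimes>\<^sub>M ?nu \<omega> = distr (mu \<omega> \<Otimes>\<^sub>M mu \<omega>) (X \<Otimes>\<^sub>M X) (\<lambda>(x, y). (x, y))"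
      by (rule pair_measure_distr[OF inc inc sf])
    have P: "Pair \<omega> \<in> X \<Otimes>\<^sub>M X \<rightarrow>\<^sub>M M \<Otimes>\<^sub>M X \<Otimes>\<^sub>M X" using \<omega> by measurable
    have "emeasure (distr (?nu \<omega> \<Otimes>\<^sub>M ?nu \<omega>) (M \<Otimes>\<^sub>M X \<Otimes>\<^sub>M X) (Pair \<omega>)) B
      = emeasure (distr (mu \<omega> \<Otimes>\<^sub>M mu \<omega>) (M \<Otimes>\<^sub>M X \<Otimes>\<^sub>M X) (Pair \<omega> \<circ> (\<lambda>(x, y). (x, y)))) B"
      unfolding nn by (subst distr_distr[OF P inc2]) simp
    also have "\<dots> = emeasure (mu \<omega> \<Otimes>\<^sub>M mu \<omega>) (Pair \<omega> -` B \<inter> space (mu \<omega> \<Otimes>\<^sub>M mu \<omega>))"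
      by (subst emeasure_distr[OF measurable_comp[OF inc2 P] B'(1)]) (auto intro!: arg_cong[where f="emeasure _"])
    also have "\<dots> = emeasure (distr (mu \<omega> \<Otimes>\<^sub>M mu \<omega>) total_space2 (Pair \<omega>)) B"
      by (simp add: emeasure_distr[OF fibre_embedding2_measurable[OF \<omega>] B])
    finally show ?thesis .
  qed
  ultimately show "(\<lambda>\<omega>. emeasure (distr (mu \<omega> \<Otimes>\<^sub>M mu \<omega>) total_space2 (Pair \<omega>)) B) \<in> borel_measurable M"
    by (simp cong: measurable_cong)
qed simp

text \<open>
  On a fibre the integral factorises: \<open>iexp (\<theta> (S x - S y)) = iexp (\<theta> S x) * cnj (iexp (\<theta> S y))\<close>.
\<close>
lemma char_diff_eq:
  assumes A: "A \<in> borel_measurable X"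
  shows "char_diff M T X Xs f mu A n \<theta>
    = complex_of_real (\<integral>\<omega>. (cmod (char (distr (mu \<omega>) borel (birkhoff T f A n \<omega>)) \<theta>))\<^sup>2 \<partial>M)"
proof -
  let ?h = "\<lambda>z. iexp (\<theta> * birkhoff_diff T f A n z)"
  have m: "?h \<in> borel_measurable total_space2"
  proof -
    have "(\<lambda>z. (fst z, fst (snd z))) \<in> total_space2 \<rightarrow>\<^sub>M total_space"
      by (rule measurable_restrict_space3) auto
    from measurable_compose[OF this birkhoff_measurable[OF A]]
    have [measurable]: "(\<lambda>z. birkhoff T f A n (fst z) (fst (snd z))) \<in> borel_measurable total_space2"
      by simp
    have "(\<lambda>z. (fst z, snd (snd z))) \<in> total_space2 \<rightarrow>\<^sub>M total_space"
      by (rule measurable_restrict_space3) auto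
    from measurable_compose[OF this birkhoff_measurable[OF A]]
    have [measurable]: "(\<lambda>z. birkhoff T f A n (fst z) (snd (snd z))) \<in> borel_measurable total_space2"
      by simp
    show ?thesis unfolding birkhoff_diff_def case_prod_unfold by measurable
  qed
  have "char_diff M T X Xs f mu A n \<theta>
      = (\<integral>\<omega>. integral\<^sup>L (distr (mu \<omega> \<Otimes>\<^sub>M mu \<omega>) total_space2 (Pair \<omega>)) ?h \<partial>M)"
    unfolding char_diff_def muhat2_def
  proof (rule complex_integral_bind[OF prob_space_axioms muhat2_kernel_measurable _ m, of 1])
    show "prob_space (distr (mu \<omega> \<Otimes>\<^sub>M mu \<omega>) total_space2 (Pair \<omega>))" if "\<omega> \<in> space M" for \<omega>
      using prob_space.prob_space_distr[OF prob_space_pair fibre_embedding2_measurable[OF that]]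
        fibre_measure_prob[OF that] by blast
  qed simp
  also have "\<dots> = (\<integral>\<omega>. complex_of_real ((cmod (char (distr (mu \<omega>) borel (birkhoff T f A n \<omega>)) \<theta>))\<^sup>2) \<partial>M)"
  proof (rule Bochner_Integration.integral_cong)
    fix \<omega> assume \<omega>: "\<omega> \<in> space M"
    interpret F: prob_space "mu \<omega>" by (rule fibre_measure_prob[OF \<omega>])
    interpret P: pair_prob_space "mu \<omega>" "mu \<omega>" ..
    define S where "S = birkhoff T f A n \<omega>"
    have [measurable]: "S \<in> borel_measurable (mu \<omega>)"
      unfolding S_def by (rule birkhoff_fibre_measurable[OF A \<omega>])
    have c: "char (distr (mu \<omega>) borel S) \<theta> = (CLINT x|mu \<omega>. iexp (\<theta> * S x))"
      unfolding char_def by (subst integral_distr) auto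
    have "integral\<^sup>L (distr (mu \<omega> \<Otimes>\<^sub>M mu \<omega>) total_space2 (Pair \<omega>)) ?h
        = (CLINT z|mu \<omega> \<Otimes>\<^sub>M mu \<omega>. iexp (\<theta> * (S (fst z) - S (snd z))))"
      by (subst integral_distr[OF fibre_embedding2_measurable[OF \<omega>] m])
        (simp add: birkhoff_diff_def S_def case_prod_unfold)
    also have "\<dots> = (CLINT x|mu \<omega>. (CLINT y|mu \<omega>. iexp (\<theta> * (S x - S y))))"
      by (subst P.integral_fst'[symmetric])
        (auto intro!: P.integrable_const_bound[of _ 1] simp del: of_real_diff of_real_mult)
    also have "\<dots> = (CLINT x|mu \<omega>. (CLINT y|mu \<omega>. iexp (\<theta> * S x) * cnj (iexp (\<theta> * S y))))"
      by (intro Bochner_Integration.integral_cong refl) (auto simp: exp_cnj algebra_simps simp flip: exp_add)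
    also have "\<dots> = char (distr (mu \<omega>) borel S) \<theta> * cnj (char (distr (mu \<omega>) borel S) \<theta>)"
      by (simp only: c integral_mult_right_zero integral_mult_left_zero Bochner_Integration.integral_cnj)
    also have "\<dots> = complex_of_real ((cmod (char (distr (mu \<omega>) borel S) \<theta>))\<^sup>2)"
      by (rule complex_norm_square[symmetric])
    finally show "integral\<^sup>L (distr (mu \<omega> \<Otimes>\<^sub>M mu \<omega>) total_space2 (Pair \<omega>)) ?h
      = complex_of_real ((cmod (char (distr (mu \<omega>) borel (birkhoff T f A n \<omega>)) \<theta>))\<^sup>2)"
      by (simp add: S_def)
  qed simp
  finally show ?thesis by (simp only: integral_complex_of_real)
qed

end

section \<open>Uniform local limit theorem\<close>
lemma gauss_lipschitz:
  fixes x y :: real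
  shows "\<bar>exp (- (x\<^sup>2 / 2)) - exp (- (y\<^sup>2 / 2))\<bar> \<le> \<bar>x - y\<bar>"
proof -
  have "norm (exp (- (x\<^sup>2 / 2)) - exp (- (y\<^sup>2 / 2))) \<le> 1 * norm (x - y)"
  proof (rule field_differentiable_bound[of UNIV])
    show "((\<lambda>z::real. exp (- (z\<^sup>2 / 2))) has_field_derivative - z * exp (- (z\<^sup>2 / 2))) (at z within UNIV)" for z
      by (auto intro!: derivative_eq_intros)
    show "norm (- z * exp (- (z\<^sup>2 / 2))) \<le> 1" for z :: real
    proof -
      have "0 \<le> (\<bar>z\<bar> - 1)\<^sup>2" by simp
      then have "\<bar>z\<bar> \<le> 1 + z\<^sup>2 / 2" by (simp add: power2_eq_square algebra_simps)
      also have "\<dots> \<le> exp (z\<^sup>2 / 2)" by (rule exp_ge_add_one_self)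
      finally show ?thesis by (simp add: abs_mult exp_minus field_simps)
    qed
  qed auto
  then show ?thesis by simp
qed

lemma integral_lattice_sum:
  fixes S :: "'a \<Rightarrow> real" and G :: "real \<Rightarrow> real" and B u :: int
  assumes "prob_space N" and [measurable]: "S \<in> borel_measurable N"
    and int: "\<And>x. x \<in> space N \<Longrightarrow> S x \<in> \<int>" and supp: "\<And>y. \<bar>y\<bar> > of_int B \<Longrightarrow> G y = 0"
  shows "(\<integral>x. G (S x - of_int u) \<partial>N) = (\<Sum>k\<in>{-B..B}. G (of_int k) * measure (distr N borel S) {of_int (u + k)})"
proof -
  interpret prob_space N by fact
  let ?A = "\<lambda>k. S -` {of_int (u + k)} \<inter> space N"
  have "(\<integral>x. G (S x - of_int u) \<partial>N) = (\<integral>x. (\<Sum>k\<in>{-B..B}. G (of_int k) * indicator (?A k) x) \<partial>N)"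
  proof (rule Bochner_Integration.integral_cong)
    fix x assume x: "x \<in> space N"
    then obtain j where j: "S x = of_int j" using int by (auto elim: Ints_cases)
    have "(\<Sum>k\<in>{-B..B}. G (of_int k) * indicator (?A k) x) = (\<Sum>k\<in>{-B..B}. if k = j - u then G (of_int k) else 0)"
      using x by (intro sum.cong) (auto simp: indicator_def j simp flip: of_int_add)
    also have "\<dots> = (if j - u \<in> {-B..B} then G (of_int (j - u)) else 0)"
      by (simp add: sum.delta)
    also have "\<dots> = G (of_int (j - u))"
      using supp[of "of_int (j - u)"] by auto
    finally show "G (S x - of_int u) = (\<Sum>k\<in>{-B..B}. G (of_int k) * indicator (?A k) x)"
      by (simp add: j)
  qed simp
  also have "\<dots> = (\<Sum>k\<in>{-B..B}. G (of_int k) * measure N (?A k))"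
  proof (subst Bochner_Integration.integral_sum)
    have "integrable N (indicator (?A k) :: _ \<Rightarrow> real)" for k
      by (intro integrable_real_indicator) (auto simp: less_top[symmetric])
    then show "integrable N (\<lambda>x. G (of_int k) * indicator (?A k) x)" for k
      by (rule integrable_mult_right)
  qed (auto simp: Int_absorb2)
  also have "\<dots> = (\<Sum>k\<in>{-B..B}. G (of_int k) * measure (distr N borel S) {of_int (u + k)})"
    by (intro sum.cong refl) (simp add: measure_distr)
  finally show ?thesis .
qed

text \<open>
  Each of the finitely many lattice points contributes the error \<open>d\<close> of the local limit theorem and
  the change of the Gaussian weight from \<open>u\<close> to \<open>u + k\<close>, at most \<open>|k| / sqrt n\<close>.
\<close>
lemma lattice_sum_error_bound:
  fixes G :: "real \<Rightarrow> real" and P :: "int \<Rightarrow> real" and B u :: int and n d :: real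
  assumes n: "n > 0" and P: "\<And>m. \<bar>sqrt (2 * pi * n) * P m - exp (- ((of_int m)\<^sup>2 / (2 * n)))\<bar> \<le> d"
  shows "\<bar>sqrt (2 * pi * n) * (\<Sum>k\<in>{-B..B}. G (of_int k) * P (u + k))
      - exp (- ((of_int u)\<^sup>2 / (2 * n))) * (\<Sum>k\<in>{-B..B}. G (of_int k))\<bar>
    \<le> (\<Sum>k\<in>{-B..B}. \<bar>G (of_int k)\<bar>) * d + (\<Sum>k\<in>{-B..B}. \<bar>G (of_int k)\<bar> * \<bar>of_int k\<bar>) / sqrt n"
proof -
  define e where "e m = exp (- ((of_int m)\<^sup>2 / (2 * n)))" for m :: int
  have "sqrt (2 * pi * n) * (\<Sum>k\<in>{-B..B}. G (of_int k) * P (u + k)) - e u * (\<Sum>k\<in>{-B..B}. G (of_int k))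
    = (\<Sum>k\<in>{-B..B}. G (of_int k) * (sqrt (2 * pi * n) * P (u + k) - e u))"
    by (simp add: sum_distrib_left right_diff_distrib sum_subtractf mult_ac)
  also have "\<bar>\<dots>\<bar> \<le> (\<Sum>k\<in>{-B..B}. \<bar>G (of_int k) * (sqrt (2 * pi * n) * P (u + k) - e u)\<bar>)"
    by (rule sum_abs)
  also have "\<dots> \<le> (\<Sum>k\<in>{-B..B}. \<bar>G (of_int k)\<bar> * (d + \<bar>of_int k\<bar> / sqrt n))"
  proof (rule sum_mono)
    fix k
    have ge: "e m = exp (- ((of_int m / sqrt n)\<^sup>2 / 2))" for m
      using n by (simp add: e_def power_divide mult.commute)
    have "\<bar>e (u + k) - e u\<bar> \<le> \<bar>of_int (u + k) / sqrt n - of_int u / sqrt n\<bar>"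
      unfolding ge by (rule gauss_lipschitz)
    also have "\<dots> = \<bar>of_int k\<bar> / sqrt n"
      using n by (simp add: add_divide_distrib abs_divide)
    finally have "\<bar>sqrt (2 * pi * n) * P (u + k) - e u\<bar> \<le> d + \<bar>of_int k\<bar> / sqrt n"
      using P[of "u + k"] unfolding e_def by linarith
    then show "\<bar>G (of_int k) * (sqrt (2 * pi * n) * P (u + k) - e u)\<bar> \<le> \<bar>G (of_int k)\<bar> * (d + \<bar>of_int k\<bar> / sqrt n)"
      unfolding abs_mult by (intro mult_left_mono) auto
  qed
  also have "\<dots> = (\<Sum>k\<in>{-B..B}. \<bar>G (of_int k)\<bar>) * d + (\<Sum>k\<in>{-B..B}. \<bar>G (of_int k)\<bar> * \<bar>of_int k\<bar>) / sqrt n"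
    by (simp add: distrib_left sum.distrib sum_distrib_right sum_divide_distrib)
  finally show ?thesis by (simp add: e_def)
qed

lemma bounded_support:
  fixes G :: "real \<Rightarrow> real"
  assumes "(continuous_on UNIV G \<and> compact (closure {x. G x \<noteq> 0})) \<or>
    (\<exists>I. is_interval I \<and> bounded I \<and> G = indicator I)"
  obtains B :: int where "\<And>y. \<bar>y\<bar> > of_int B \<Longrightarrow> G y = 0"
proof -
  have "bounded {x. G x \<noteq> 0}"
    using assms
  proof
    assume "continuous_on UNIV G \<and> compact (closure {x. G x \<noteq> 0})"
    then show ?thesis using compact_imp_bounded bounded_subset closure_subset by blast
  next
    assume "\<exists>I. is_interval I \<and> bounded I \<and> G = indicator I"
    then show ?thesis by (auto elim!: bounded_subset simp: indicator_def split: if_splits)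
  qed
  then obtain R where R: "\<And>x. G x \<noteq> 0 \<Longrightarrow> \<bar>x\<bar> \<le> R"
    by (auto simp: bounded_iff)
  have "G y = 0" if "\<bar>y\<bar> > of_int \<lceil>R\<rceil>" for y
    using R[of y] that le_of_int_ceiling[of R] by linarith
  then show ?thesis by (rule that)
qed

lemma infsum_lattice:
  fixes G :: "real \<Rightarrow> real" and B :: int
  assumes "\<And>y. \<bar>y\<bar> > of_int B \<Longrightarrow> G y = 0"
  shows "(\<Sum>\<^sub>\<infinity>k\<in>(UNIV :: int set). G (of_int k)) = (\<Sum>k\<in>{-B..B}. G (of_int k))"
proof -
  have "(\<Sum>\<^sub>\<infinity>k\<in>(UNIV :: int set). G (of_int k)) = (\<Sum>\<^sub>\<infinity>k\<in>{-B..B}. G (of_int k))"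
    by (rule infsum_cong_neutral) (auto intro!: assms simp flip: of_int_abs)
  then show ?thesis by simp
qed

text \<open>
  The \<open>L\<^sup>1\<close> hypothesis is used twice: for the increment from \<open>k\<close> to \<open>n\<close>, and from \<open>0\<close> to \<open>k\<close>, where it bounds
  \<open>S\<^sub>k\<close> itself. The constants may be increased, in particular made nonnegative.
\<close>
lemma (in fibred_system) char_birkhoff_dist_le:
  assumes A: "A \<in> borel_measurable X" and \<omega>: "\<omega> \<in> space M"
    and L1: "\<And>n k. k < n \<Longrightarrow> (\<integral>\<^sup>+x. ennreal \<bar>birkhoff T f A n \<omega> x - birkhoff T f A k \<omega> x\<bar> \<partial>mu \<omega>)
              \<le> ennreal (K * real n powr (\<delta>0 / 2) * real (n - k) powr (1 / 2))"
    and K': "max K 0 \<le> K'" and \<delta>: "\<delta>0 \<le> \<delta>'" and "k < n"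
  shows "cmod (char (distr (mu \<omega>) borel (birkhoff T f A n \<omega>)) s - char (distr (mu \<omega>) borel (birkhoff T f A k \<omega>)) t)
        \<le> \<bar>s\<bar> * (K' * real n powr (\<delta>' / 2) * real (n - k) powr (1 / 2))
          + \<bar>s - t\<bar> * (K' * real k powr (\<delta>' / 2) * real k powr (1 / 2))"
proof -
  have K: "K * real n powr (\<delta>0 / 2) * y \<le> K' * real n powr (\<delta>' / 2) * y" if "n \<ge> 1" "y \<ge> 0" for n y
  proof -
    have "K * real n powr (\<delta>0 / 2) \<le> K' * real n powr (\<delta>0 / 2)"
      using K' by (intro mult_right_mono) auto
    also have "\<dots> \<le> K' * real n powr (\<delta>' / 2)"
      using K' \<delta> that by (intro mult_left_mono powr_mono) auto
    finally show ?thesis using that(2) by (rule mult_right_mono)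
  qed
  have B: "(\<integral>\<^sup>+x. ennreal \<bar>birkhoff T f A n \<omega> x - birkhoff T f A k \<omega> x\<bar> \<partial>mu \<omega>)
     \<le> ennreal (K' * real n powr (\<delta>' / 2) * real (n - k) powr (1 / 2))" if "k < n" for n k
    using L1[OF that] K[of n "real (n - k) powr (1 / 2)"] that
    by (auto elim!: order_trans intro!: ennreal_leI)
  show ?thesis
  proof (rule char_dist_le[OF fibre_measure_prob[OF \<omega>]])
    show "(\<integral>\<^sup>+x. ennreal \<bar>birkhoff T f A n \<omega> x - birkhoff T f A k \<omega> x\<bar> \<partial>mu \<omega>)
     \<le> ennreal (K' * real n powr (\<delta>' / 2) * real (n - k) powr (1 / 2))"
      using \<open>k < n\<close> by (rule B)
    show "(\<integral>\<^sup>+x. ennreal \<bar>birkhoff T f A k \<omega> x\<bar> \<partial>mu \<omega>) \<le> ennreal (K' * real k powr (\<delta>' / 2) * real k powr (1 / 2))"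
    proof (cases "k = 0")
      case True
      then show ?thesis by (simp add: birkhoff_def)
    next
      case False
      then show ?thesis using B[of 0 k] by (simp add: birkhoff_def)
    qed
  qed (use birkhoff_fibre_measurable[OF A \<omega>] K' in auto)
qed

text \<open>
  The local limit theorem for the point probabilities of \<open>S\<^sub>n\<close>, with one almost sure set for all lattice
  points; the error \<open>d\<close> may depend on \<open>\<omega>\<close>. The interpolation argument needs a nonnegative exponent, so
  \<open>\<delta>0\<close> is replaced by its positive part, which is still below \<open>1/\<alpha>\<close>.
\<close>
lemma (in fibred_system) uniform_local_limit:
  assumes A: "A \<in> borel_measurable X" and A_int: "\<And>x. x \<in> space X \<Longrightarrow> A x \<in> \<int>"
    and \<zeta>: "\<eta> > \<zeta>" "\<zeta> > 0" and \<alpha>: "\<alpha> > 1 / (\<eta> - \<zeta>)" and \<delta>0: "\<delta>0 < 1 / \<alpha>"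
    and \<phi>2: "(\<lambda>n::nat. LBINT t:{t. \<bar>t\<bar> \<le> ln (real n)}.
            cmod (char_diff M T X Xs f mu A n (t / sqrt (real n)) - complex_of_real (exp (- (t^2)))))
          \<in> O(\<lambda>n. real n powr (- \<eta>))"
    and \<phi>1: "(\<lambda>n::nat. LBINT t:{t. \<bar>t\<bar> \<le> ln (real n)}.
            cmod (char_sum M T X Xs f mu A n (t / sqrt (real n)) - complex_of_real (exp (- (t^2 / 2)))))
          \<in> O(\<lambda>n. real n powr (- \<eta>))"
    and L1: "AE \<omega> in M. \<exists>K::real. \<forall>n k. k < n \<longrightarrow>
            (\<integral>\<^sup>+x. ennreal \<bar>birkhoff T f A n \<omega> x - birkhoff T f A k \<omega> x\<bar> \<partial>mu \<omega>)
              \<le> ennreal (K * real n powr (\<delta>0 / 2) * real (n - k) powr (1 / 2))"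
    and pos: "C > 0" "c > 0" "b > 2"
    and near: "\<And>\<theta> (n::nat). \<theta> \<in> {-\<delta>..\<delta>} \<Longrightarrow>
            cmod (char_diff M T X Xs f mu A n \<theta>) \<le> C * exp (- (c * \<theta>^2 * real n))"
    and far: "(\<lambda>n::nat. LBINT \<theta>:{\<theta>. \<delta> \<le> \<bar>\<theta>\<bar> \<and> \<bar>\<theta>\<bar> \<le> pi}. cmod (char_diff M T X Xs f mu A n \<theta>))
          \<in> O(\<lambda>n. real n powr (- b))"
  shows "AE \<omega> in M. \<exists>d. d \<longlonglongrightarrow> 0 \<and> (\<forall>n\<ge>1. \<forall>m::int.
      \<bar>sqrt (2 * pi * real n) * measure (distr (mu \<omega>) borel (birkhoff T f A n \<omega>)) {of_int m}
        - exp (- ((of_int m)\<^sup>2 / (2 * real n)))\<bar> \<le> d n)"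
proof -
  define Q where "Q n \<omega> = distr (mu \<omega>) borel (birkhoff T f A n \<omega>)" for n \<omega>
  define p where "p k = nat \<lceil>real k powr \<alpha>\<rceil>" for k
  define \<delta>' where "\<delta>' = max \<delta>0 0"
  have Q: "Q n \<in> M \<rightarrow>\<^sub>M prob_algebra borel" for n
    unfolding Q_def by (rule birkhoff_distr_measurable[OF A])
  have \<alpha>0: "\<alpha> > 0" using \<alpha> \<zeta> by (smt (verit) divide_pos_pos)
  have \<alpha>1: "\<alpha> * (\<eta> - \<zeta>) > 1" using \<alpha> \<zeta> by (simp add: field_simps)
  have \<delta>': "0 \<le> \<delta>'" "\<delta>0 \<le> \<delta>'" "\<delta>' < 1 / \<alpha>" using \<delta>0 \<alpha>0 by (auto simp: \<delta>'_def)
  have dif: "char_diff M T X Xs f mu A n \<theta> = complex_of_real (\<integral>\<omega>. (cmod (char (Q n \<omega>) \<theta>))\<^sup>2 \<partial>M)" for n \<theta>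
    unfolding Q_def by (rule char_diff_eq[OF A])
  have sum: "char_sum M T X Xs f mu A n \<theta> = (\<integral>\<omega>. char (Q n \<omega>) \<theta> \<partial>M)" for n \<theta>
    unfolding Q_def by (rule char_sum_eq[OF A])
  have cd: "cmod (char_diff M T X Xs f mu A n \<theta>) = (\<integral>\<omega>. (cmod (char (Q n \<omega>) \<theta>))\<^sup>2 \<partial>M)" for n \<theta>
    unfolding dif norm_of_real by (rule abs_of_nonneg) simp
  have cd': "cmod (char_diff M T X Xs f mu A n \<theta> - complex_of_real e)
      = \<bar>(\<integral>\<omega>. (cmod (char (Q n \<omega>) \<theta>))\<^sup>2 \<partial>M) - e\<bar>" for n \<theta> e
    unfolding dif of_real_diff[symmetric] norm_of_real ..
  have outer: "AE \<omega> in M. (\<lambda>n. sqrt (real n) *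
      (LBINT \<theta>:{\<theta>. ln (real n) / 2 / sqrt (real n) < \<bar>\<theta>\<bar> \<and> \<bar>\<theta>\<bar> \<le> pi}. cmod (char (Q n \<omega>) \<theta>))) \<longlonglongrightarrow> 0"
  proof (rule outer_part_tendsto_0[OF prob_space_axioms Q pos])
    show "(\<integral>\<omega>. (cmod (char (Q n \<omega>) \<theta>))\<^sup>2 \<partial>M) \<le> C * exp (- (c * \<theta>\<^sup>2 * real n))" if "\<bar>\<theta>\<bar> \<le> \<delta>" for \<theta> n
      using near[of \<theta> n] that by (simp add: cd abs_le_iff)
    show "(\<lambda>n. LBINT \<theta>:{\<theta>. \<delta> \<le> \<bar>\<theta>\<bar> \<and> \<bar>\<theta>\<bar> \<le> pi}. (\<integral>\<omega>. (cmod (char (Q n \<omega>) \<theta>))\<^sup>2 \<partial>M)) \<in> O(\<lambda>n. real n powr (- b))"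
      using far unfolding cd .
  qed
  have inner: "AE \<omega> in M. (\<lambda>k. LBINT t:{t. \<bar>t\<bar> \<le> ln (real (p k))}.
      cmod (char (Q (p k) \<omega>) (t / sqrt (real (p k))) - complex_of_real (exp (- (t\<^sup>2 / 2))))) \<longlonglongrightarrow> 0"
    by (rule inner_part_tendsto_0[OF prob_space_axioms Q \<phi>2[unfolded cd'] \<phi>1[unfolded sum] \<zeta>(2) \<alpha>0 \<alpha>1])
      (simp add: p_def real_nat_ceiling_ge)
  show ?thesis
    using outer inner L1 AE_space
  proof eventually_elim
    case (elim \<omega>)
    note \<omega> = \<open>\<omega> \<in> space M\<close>
    have R: "real_distribution (Q n \<omega>)" for n using Q \<omega> by (rule kernel_real_distribution)
    obtain K where K: "\<And>n k. k < n \<Longrightarrow>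
            (\<integral>\<^sup>+x. ennreal \<bar>birkhoff T f A n \<omega> x - birkhoff T f A k \<omega> x\<bar> \<partial>mu \<omega>)
              \<le> ennreal (K * real n powr (\<delta>0 / 2) * real (n - k) powr (1 / 2))"
      using elim(3) by blast
    define I where "I n = (LBINT t:{t. \<bar>t\<bar> \<le> ln (real n) / 2}.
      cmod (char (Q n \<omega>) (t / sqrt (real n)) - complex_of_real (exp (- (t\<^sup>2 / 2)))))" for n
    define O' where "O' n = sqrt (real n) *
      (LBINT \<theta>:{\<theta>. ln (real n) / 2 / sqrt (real n) < \<bar>\<theta>\<bar> \<and> \<bar>\<theta>\<bar> \<le> pi}. cmod (char (Q n \<omega>) \<theta>))" for n
    define W where "W n = (LBINT t:{t. ln (real n) / 2 < \<bar>t\<bar>}. exp (- (t\<^sup>2 / 2)))" for n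
    have "I \<longlonglongrightarrow> 0"
      unfolding I_def
    proof (rule inner_part_interpolation[OF R \<alpha>0 \<delta>'(1,3) _ _ p_def elim(2)])
      show "max K 0 \<ge> 0" by simp
      show "cmod (char (Q n \<omega>) s - char (Q k \<omega>) t)
        \<le> \<bar>s\<bar> * (max K 0 * real n powr (\<delta>' / 2) * real (n - k) powr (1 / 2))
          + \<bar>s - t\<bar> * (max K 0 * real k powr (\<delta>' / 2) * real k powr (1 / 2))" if "k < n" for n k s t
        unfolding Q_def using A \<omega> K order_refl \<delta>'(2) that by (rule char_birkhoff_dist_le)
    qed
    moreover have "O' \<longlonglongrightarrow> 0" unfolding O'_def using elim(1) .
    moreover have "W \<longlonglongrightarrow> 0"
      unfolding W_def by (rule gauss_tail_tendsto_0) real_asymp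
    ultimately have lim: "(\<lambda>n. I n + O' n + W n) \<longlonglongrightarrow> 0"
      by (auto intro!: tendsto_eq_intros)
    have "\<bar>sqrt (2 * pi * real n) * measure (Q n \<omega>) {of_int m} - exp (- ((of_int m)\<^sup>2 / (2 * real n)))\<bar>
        \<le> I n + O' n + W n" if n: "n \<ge> 1" for n m
      unfolding I_def O'_def W_def
    proof (rule local_limit_error_bound[OF R])
      show "AE x in Q n \<omega>. x \<in> \<int>"
        unfolding Q_def
      proof (subst AE_distr_iff)
        show "birkhoff T f A n \<omega> \<in> borel_measurable (mu \<omega>)"
          by (rule birkhoff_fibre_measurable[OF A \<omega>])
        show "{x \<in> space borel. x \<in> \<int>} \<in> sets (borel :: real measure)"
          using closed_Ints by (simp add: borel_closed)
        show "AE x in mu \<omega>. birkhoff T f A n \<omega> x \<in> \<int>"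
          using birkhoff_Ints[OF A_int \<omega>] space_fibre[OF \<omega>] by (intro AE_I2) auto
      qed
      show "real n > 0" using n by simp
      have "ln (real n) / 2 = ln (sqrt (real n))" using n by (simp add: ln_sqrt)
      also have "\<dots> \<le> sqrt (real n)" using n by (intro ln_bound) auto
      also have "\<dots> \<le> pi * sqrt (real n)" using mult_right_mono[of 1 pi "sqrt (real n)"] pi_gt3 by simp
      finally show "ln (real n) / 2 \<le> pi * sqrt (real n)" .
    qed
    with lim show ?case unfolding Q_def by blast
  qed
qed

theorem theorem2p8:
  fixes M :: "'w measure" and T :: "'w \<Rightarrow> 'w" and X :: "'x measure"
    and Xs :: "'w \<Rightarrow> 'x set" and f :: "'w \<Rightarrow> 'x \<Rightarrow> 'x" and mu :: "'w \<Rightarrow> 'x measure"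
    and A :: "'x \<Rightarrow> real" and \<eta> \<zeta> \<alpha> r \<delta>0 \<delta> C c b :: real
  assumes "fibred_system M T X Xs f mu"
    and "A \<in> borel_measurable X"
    and "\<And>x. x \<in> space X \<Longrightarrow> A x \<in> \<int>"
    and "\<eta> > \<zeta>" and "\<zeta> > 0" and "\<alpha> > 1 / (\<eta> - \<zeta>)" and "\<alpha> * (\<eta> - \<zeta>) > 1 + r" and "\<delta>0 < 1 / \<alpha>"
    and "(\<lambda>n::nat. LBINT t:{t. \<bar>t\<bar> \<le> ln (real n)}.
            cmod (char_diff M T X Xs f mu A n (t / sqrt (real n)) - complex_of_real (exp (- (t^2)))))
          \<in> O(\<lambda>n. real n powr (- \<eta>))"
    and "(\<lambda>n::nat. LBINT t:{t. \<bar>t\<bar> \<le> ln (real n)}.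
            cmod (char_sum M T X Xs f mu A n (t / sqrt (real n)) - complex_of_real (exp (- (t^2 / 2)))))
          \<in> O(\<lambda>n. real n powr (- \<eta>))"
    and "AE \<omega> in M. \<exists>K::real. \<forall>n k. k < n \<longrightarrow>
            (\<integral>\<^sup>+x. ennreal \<bar>birkhoff T f A n \<omega> x - birkhoff T f A k \<omega> x\<bar> \<partial>mu \<omega>)
              \<le> ennreal (K * real n powr (\<delta>0 / 2) * real (n - k) powr (1 / 2))"
    and "0 < \<delta>" and "\<delta> < 1" and "C > 0" and "c > 0" and "b > 2"
    and "\<And>\<theta> (n::nat). \<theta> \<in> {-\<delta>..\<delta>} \<Longrightarrow>
            cmod (char_diff M T X Xs f mu A n \<theta>) \<le> C * exp (- (c * \<theta>^2 * real n))"
    and "(\<lambda>n::nat. LBINT \<theta>:{\<theta>. \<delta> \<le> \<bar>\<theta>\<bar> \<and> \<bar>\<theta>\<bar> \<le> pi}. cmod (char_diff M T X Xs f mu A n \<theta>))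
          \<in> O(\<lambda>n. real n powr (- b))"
  shows "\<forall>G :: real \<Rightarrow> real.
           (continuous_on UNIV G \<and> compact (closure {x. G x \<noteq> 0})) \<or>
           (\<exists>I. is_interval I \<and> bounded I \<and> G = indicator I) \<longrightarrow>
           (AE \<omega> in M.
             (\<lambda>n::nat. SUP u::int. ennreal
                \<bar>sqrt (2 * pi * real n) * (\<integral>x. G (birkhoff T f A n \<omega> x - real_of_int u) \<partial>mu \<omega>)
                 - exp (- ((real_of_int u)^2 / (2 * real n))) * (\<Sum>\<^sub>\<infinity>k\<in>(UNIV :: int set). G (real_of_int k))\<bar>)
             \<longlonglongrightarrow> 0)"
proof (intro allI impI)
  interpret fibred_system M T X Xs f mu by fact
  fix G :: "real \<Rightarrow> real"
  assume "(continuous_on UNIV G \<and> compact (closure {x. G x \<noteq> 0})) \<or>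
           (\<exists>I. is_interval I \<and> bounded I \<and> G = indicator I)"
  then obtain B :: int where B: "\<And>y. \<bar>y\<bar> > of_int B \<Longrightarrow> G y = 0"
    by (rule bounded_support) blast
  have "AE \<omega> in M. \<exists>d. d \<longlonglongrightarrow> 0 \<and> (\<forall>n\<ge>1. \<forall>m::int.
      \<bar>sqrt (2 * pi * real n) * measure (distr (mu \<omega>) borel (birkhoff T f A n \<omega>)) {of_int m}
        - exp (- ((of_int m)\<^sup>2 / (2 * real n)))\<bar> \<le> d n)"
    by (rule uniform_local_limit[OF assms(2-6,8-11,14-18)])
  then show "AE \<omega> in M.
             (\<lambda>n::nat. SUP u::int. ennreal
                \<bar>sqrt (2 * pi * real n) * (\<integral>x. G (birkhoff T f A n \<omega> x - real_of_int u) \<partial>mu \<omega>)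
                 - exp (- ((real_of_int u)^2 / (2 * real n))) * (\<Sum>\<^sub>\<infinity>k\<in>(UNIV :: int set). G (real_of_int k))\<bar>)
             \<longlonglongrightarrow> 0"
    using AE_space
  proof eventually_elim
    case (elim \<omega>)
    note \<omega> = \<open>\<omega> \<in> space M\<close>
    obtain d where d: "d \<longlonglongrightarrow> 0" and local: "\<And>n m. n \<ge> 1 \<Longrightarrow>
      \<bar>sqrt (2 * pi * real n) * measure (distr (mu \<omega>) borel (birkhoff T f A n \<omega>)) {of_int m}
        - exp (- ((of_int m)\<^sup>2 / (2 * real n)))\<bar> \<le> d n"
      using elim(1) by blast
    define a where "a = (\<Sum>k\<in>{-B..B}. \<bar>G (of_int k)\<bar>)"
    define a' where "a' = (\<Sum>k\<in>{-B..B}. \<bar>G (of_int k)\<bar> * \<bar>of_int k\<bar>)"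
    have sum: "(\<integral>x. G (birkhoff T f A n \<omega> x - real_of_int u) \<partial>mu \<omega>)
        = (\<Sum>k\<in>{-B..B}. G (of_int k) * measure (distr (mu \<omega>) borel (birkhoff T f A n \<omega>)) {of_int (u + k)})" for n u
      using fibre_measure_prob[OF \<omega>] birkhoff_fibre_measurable[OF assms(2) \<omega>] _ B
    proof (rule integral_lattice_sum)
      show "birkhoff T f A n \<omega> x \<in> \<int>" if "x \<in> space (mu \<omega>)" for x
        using birkhoff_Ints[OF assms(3) \<omega>] space_fibre[OF \<omega>] that by simp
    qed
    have infsum: "(\<Sum>\<^sub>\<infinity>k\<in>(UNIV :: int set). G (real_of_int k)) = (\<Sum>k\<in>{-B..B}. G (of_int k))"
      by (rule infsum_lattice) (rule B)
    have bound: "\<forall>\<^sub>F n in sequentially. (SUP u::int. ennreal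
        \<bar>sqrt (2 * pi * real n) * (\<integral>x. G (birkhoff T f A n \<omega> x - real_of_int u) \<partial>mu \<omega>)
         - exp (- ((real_of_int u)^2 / (2 * real n))) * (\<Sum>\<^sub>\<infinity>k\<in>(UNIV :: int set). G (real_of_int k))\<bar>)
        \<le> ennreal (a * d n + a' / sqrt (real n))"
      using eventually_ge_at_top[of 1]
    proof eventually_elim
      case (elim n)
      then show ?case
        unfolding sum infsum a_def a'_def
        by (intro SUP_least ennreal_leI lattice_sum_error_bound local) auto
    qed
    have "(\<lambda>n. a' / sqrt (real n)) \<longlonglongrightarrow> 0" by real_asymp
    then have "(\<lambda>n. a * d n + a' / sqrt (real n)) \<longlonglongrightarrow> 0"
      using tendsto_mult_right_zero[OF d, of a] by (intro tendsto_add_zero)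
    then have lim: "(\<lambda>n. ennreal (a * d n + a' / sqrt (real n))) \<longlonglongrightarrow> 0"
      using tendsto_ennrealI by fastforce
    show ?case
      by (rule tendsto_sandwich[OF _ bound tendsto_const lim]) simp
  qed
qed

end
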